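(* Let $A\in\mathbb{C}^{n\times n}$ be Hermitian positive definite, let $\mathbf{y},\mathbf{z}\in\mathbb{C}^n$ with $\|\mathbf{y}\|=\|\mathbf{z}\|=1$, let $\eta\in\mathbb{C}$, and let $f$ be a Stieltjes function (defined in the context). Then the Arnoldi approximations $L_m^{\mathrm{Arn}}$ of the Fréchet derivative $L_f(A,\eta\mathbf{y}\mathbf{z}^H)$ (defined in the context) satisfy $$\|L_f(A,\eta\mathbf{y}\mathbf{z}^H)-L_m^{\mathrm{Arn}}\|\le 4\,|\eta\,f'(\lambda_{\min})|\left(\frac{\sqrt{\kappa}-1}{\sqrt{\kappa}+1}\right)^m,$$ where $\lambda_{\min}$ is the smallest eigenvalue of $A$ and $\kappa$ is the Euclidean norm condition number of $A$.
   Context: $\|\cdot\|$ is the Euclidean vector norm and the matrix 2-norm; ${}^H$ is the conjugate transpose; $\mathbf{e}_1$ is the first canonical unit vector of $\mathbb{C}^m$. The Fréchet derivative $L_f(A,\cdot)$ of a matrix function $f$ at $A$ is the unique linear operator with $f(A+E)-f(A)=L_f(A,E)+o(\|E\|)$. A Stieltjes function is a function $f(z)=\int_0^\infty\frac{1}{z+t}\,d\mu(t)$, $z\in\mathbb{C}\setminus(-\infty,0]$, where $\mu$ is a nonnegative, monotonically increasing function with $\int_0^\infty\frac{1}{1+t}\,d\mu(t)<\infty$; for a matrix $M$ with no eigenvalue in $(-\infty,0]$, $f(M)=\int_0^\infty(M+tI)^{-1}\,d\mu(t)$. Arnoldi approximation: let $\mathcal{K}_m(A,\mathbf{y})=\mathrm{span}\{\mathbf{y},A\mathbf{y},\dots,A^{m-1}\mathbf{y}\}$.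 Here $m\ge1$ is such that $\mathcal{K}_m(A,\mathbf{y})$ and $\mathcal{K}_m(A^H,\mathbf{z})$ both have dimension $m$. Let $V_m,W_m\in\mathbb{C}^{n\times m}$ have orthonormal columns forming bases of $\mathcal{K}_m(A,\mathbf{y})$ and $\mathcal{K}_m(A^H,\mathbf{z})$ generated by the Arnoldi process, so that $V_m\mathbf{e}_1=\mathbf{y}/\|\mathbf{y}\|$, $W_m\mathbf{e}_1=\mathbf{z}/\|\mathbf{z}\|$, and let $G_m=V_m^HAV_m$, $H_m=W_m^HA^HW_m$. Then $L_m^{\mathrm{Arn}}:=V_mX_mW_m^H$, where $X_m\in\mathbb{C}^{m\times m}$ is the $(1,2)$-block of $$f\left(\begin{bmatrix}G_m&\eta\|\mathbf{y}\|\|\mathbf{z}\|\mathbf{e}_1\mathbf{e}_1^H\\0&H_m^H\end{bmatrix}\right),$$ i.e. $X_m=-\eta\|\mathbf{y}\|\|\mathbf{z}\|\int_0^\infty(G_m+tI)^{-1}\mathbf{e}_1\mathbf{e}_1^H(H_m^H+tI)^{-1}\,d\mu(t)$. *)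

theory Defs
  imports "HOL-Analysis.Analysis"
begin

section \<open>Complex matrices\<close>

text \<open>The scalar product is antilinear in the first argument; the library's inner product on
  \<^typ>\<open>complex^'n\<close> is its real part and induces the same (Euclidean) norm.\<close>

definition cinner :: "complex^'n \<Rightarrow> complex^'n \<Rightarrow> complex" where
  "cinner x y = (\<Sum>i\<in>UNIV. cnj (x $ i) * y $ i)"

definition ctranspose :: "complex^'n^'m \<Rightarrow> complex^'m^'n" where
  "ctranspose M = (\<chi> i j. cnj (M $ j $ i))"

definition outer :: "complex^'m \<Rightarrow> complex^'n \<Rightarrow> complex^'n^'m" where
  "outer x y = (\<chi> i j. x $ i * cnj (y $ j))"

definition hermitian_pos_def :: "complex^'n^'n \<Rightarrow> bool" where
  "hermitian_pos_def A \<longleftrightarrow> ctranspose A = A \<and> (\<forall>x. x \<noteq> 0 \<longrightarrow> 0 < Re (cinner x (A *v x)))"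

text \<open>The library's \<^const>\<open>norm\<close> on matrices is the Frobenius norm, so the matrix 2-norm is
  introduced separately.\<close>

definition norm2 :: "complex^'n^'m \<Rightarrow> real" where
  "norm2 M = onorm (\<lambda>x. M *v x)"

definition condition_number :: "complex^'n^'n \<Rightarrow> real" where
  "condition_number A = norm2 A * norm2 (matrix_inv A)"

definition eigenvalue :: "complex^'n^'n \<Rightarrow> complex \<Rightarrow> bool" where
  "eigenvalue A l \<longleftrightarrow> (\<exists>v. v \<noteq> 0 \<and> A *v v = l *s v)"

text \<open>Used for Hermitian matrices only, all of whose eigenvalues are real.\<close>

definition smallest_eigenvalue :: "complex^'n^'n \<Rightarrow> real" where
  "smallest_eigenvalue A = Min {l. eigenvalue A (complex_of_real l)}"

section \<open>Stieltjes functions\<close>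

text \<open>The Lebesgue-Stieltjes measure of an increasing function \<open>\<mu>\<close> on \<open>[0, \<infinity>)\<close>. Only
  right-continuous functions may be passed to \<^const>\<open>interval_measure\<close>, hence the right limit,
  which does not affect integrals of continuous functions. Continuing \<open>\<mu>\<close> by \<open>\<mu> 0\<close> to the left
  gives the point \<open>0\<close> the mass \<open>\<mu>(0+) - \<mu>(0)\<close>, as in the Riemann-Stieltjes integral over
  \<open>[0, \<infinity>)\<close>; the point mass at \<open>0\<close> is needed for functions such as \<open>1/z\<close>.\<close>

definition stieltjes_measure :: "(real \<Rightarrow> real) \<Rightarrow> real measure" where
  "stieltjes_measure \<mu> = interval_measure (\<lambda>t. if t < 0 then \<mu> 0 else Lim (at_right t) \<mu>)"

definition stieltjes_function :: "(complex \<Rightarrow> complex) \<Rightarrow> (real \<Rightarrow> real) \<Rightarrow> bool" where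
  "stieltjes_function f \<mu> \<longleftrightarrow>
     (\<forall>t\<ge>0. 0 \<le> \<mu> t) \<and> mono_on {0..} \<mu> \<and>
     set_integrable (stieltjes_measure \<mu>) {0..} (\<lambda>t. 1 / (1 + t)) \<and>
     (\<forall>z. z \<notin> \<real>\<^sub>\<le>\<^sub>0 \<longrightarrow> f z = (LINT t:{0..}|stieltjes_measure \<mu>. 1 / (z + complex_of_real t)))"

text \<open>The matrix function \<open>f(M)\<close> for the Stieltjes function \<open>f\<close> generated by \<open>\<mu>\<close>; meaningful
  for \<open>M\<close> without eigenvalues in \<open>(-\<infinity>, 0]\<close>. Note that \<^term>\<open>mat c\<close> is \<open>c\<close> times the
  identity matrix.\<close>

definition stieltjes_matrix_fun :: "(real \<Rightarrow> real) \<Rightarrow> complex^'n^'n \<Rightarrow> complex^'n^'n" where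
  "stieltjes_matrix_fun \<mu> M =
     (LINT t:{0..}|stieltjes_measure \<mu>. matrix_inv (M + mat (complex_of_real t)))"

section \<open>Krylov spaces and the Arnoldi approximation\<close>

definition krylov :: "complex^'n^'n \<Rightarrow> complex^'n \<Rightarrow> nat \<Rightarrow> (complex^'n) set" where
  "krylov A y m = vec.span ((\<lambda>k. ((\<lambda>x. A *v x) ^^ k) y) ` {..<m})"

fun arnoldi :: "complex^'n^'n \<Rightarrow> complex^'n \<Rightarrow> nat \<Rightarrow> complex^'n" where
  "arnoldi A y 0 = (1 / norm y) *\<^sub>R y"
| "arnoldi A y (Suc j) =
    (let u = A *v arnoldi A y j;
         w = u - (\<Sum>i\<le>j. cinner (arnoldi A y i) u *s arnoldi A y i)
     in (1 / norm w) *\<^sub>R w)"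

text \<open>The \<open>m\<close> columns are indexed by a linearly ordered finite type \<open>'m\<close> with \<open>CARD('m) = m\<close>;
  the column at position \<open>j\<close> (counted from \<open>0\<close>) has exactly \<open>j\<close> indices below it.\<close>

definition arnoldi_basis :: "complex^'n^'n \<Rightarrow> complex^'n \<Rightarrow> complex^('m::{finite,linorder})^'n" where
  "arnoldi_basis A y = (\<chi> k j. arnoldi A y (card {i. i < j}) $ k)"

definition unit1 :: "complex^('m::{finite,linorder})" where
  "unit1 = axis (Min UNIV) 1"

definition block_matrix ::
  "complex^'m^'m \<Rightarrow> complex^'m^'m \<Rightarrow> complex^'m^'m \<Rightarrow> complex^'m^'m \<Rightarrow> complex^('m + 'm)^('m + 'm)" where
  "block_matrix P Q R S = (\<chi> i j.
     case i of
       Inl i' \<Rightarrow> (case j of Inl j' \<Rightarrow> P $ i' $ j' | Inr j' \<Rightarrow> Q $ i' $ j')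
     | Inr i' \<Rightarrow> (case j of Inl j' \<Rightarrow> R $ i' $ j' | Inr j' \<Rightarrow> S $ i' $ j'))"

definition block12 :: "complex^('m + 'm)^('m + 'm) \<Rightarrow> complex^'m^'m" where
  "block12 M = (\<chi> i j. M $ Inl i $ Inr j)"

text \<open>The approximation built from given bases \<open>V\<close>, \<open>W\<close>, whose type carries the dimension.\<close>

definition arnoldi_approx ::
  "(real \<Rightarrow> real) \<Rightarrow> complex^'n^'n \<Rightarrow> complex \<Rightarrow> complex^'n \<Rightarrow> complex^'n \<Rightarrow>
   complex^('m::{finite,linorder})^'n \<Rightarrow> complex^('m::{finite,linorder})^'n \<Rightarrow> complex^'n^'n" where
  "arnoldi_approx \<mu> A \<eta> y z V W =
    (let G = ctranspose V ** A ** V;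
         H = ctranspose W ** ctranspose A ** W;
         X = block12 (stieltjes_matrix_fun \<mu>
               (block_matrix G (outer ((\<eta> * norm y * norm z) *s unit1) unit1) 0 (ctranspose H)))
     in V ** X ** ctranspose W)"

end

theory Submission
  imports Defs
begin

text \<open>With \<open>B = A + t I\<close>, the integrand of the error is the difference of the rank-one matrices
  \<open>x w\<^sup>H\<close> and \<open>x' w'\<^sup>H\<close>, where \<open>x = B\<^sup>-\<^sup>1 y\<close>, \<open>w = B\<^sup>-\<^sup>1 z\<close> and \<open>x'\<close>, \<open>w'\<close> are their Galerkin
  approximations from the Krylov spaces. Optimality of \<open>x'\<close> in the energy norm of \<open>B\<close> gives
  \<open>\<lambda> \<parallel>x - x'\<parallel>\<^sup>2 \<le> \<parallel>p(B) x\<parallel>\<^sub>B\<^sup>2 = \<langle>y, p(B)\<^sup>2 B\<^sup>-\<^sup>1 y\<rangle> \<le> max p\<^sup>2 / \<lambda>\<close> with \<open>\<lambda> = \<lambda>\<^sub>m\<^sub>i\<^sub>n + t\<close> and a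
  normalised Chebyshev polynomial \<open>p\<close>, so the two factors \<open>\<lambda>\<close> combine and no power of the condition
  number is lost. As the condition number of \<open>B\<close> is at most that of \<open>A\<close>, both Galerkin errors are
  at most \<open>2 \<rho>\<^sup>m / \<lambda>\<close>, the integrand is at most \<open>4 \<bar>\<eta>\<bar> \<rho>\<^sup>m / \<lambda>\<^sup>2\<close>, and the integral of
  \<open>1 / (\<lambda>\<^sub>m\<^sub>i\<^sub>n + t)\<^sup>2\<close> is \<open>- f'(\<lambda>\<^sub>m\<^sub>i\<^sub>n)\<close>.\<close>

section \<open>Selfadjoint operators on invariant subspaces\<close>

text \<open>The Rayleigh quotient of \<open>T\<close> attains its maximum \<open>s\<close> on the unit sphere of \<open>S\<close> at some \<open>v\<close>.
  As the form of \<open>s - T\<close> is nonnegative on \<open>S\<close> and vanishes at \<open>v\<close>, its gradient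
  \<open>s *\<^sub>R v - T v\<close>, which lies in \<open>S\<close>, is zero.\<close>

lemma selfadjoint_max_eigenvector:
  fixes T :: "'a::euclidean_space \<Rightarrow> 'a"
  assumes lin: "linear T" and sa: "\<And>x y. x \<bullet> T y = T x \<bullet> y"
    and S: "subspace S" and inv: "\<And>x. x \<in> S \<Longrightarrow> T x \<in> S" and "u \<in> S" "u \<noteq> 0"
  obtains v s where "v \<in> S" "v \<noteq> 0" "T v = s *\<^sub>R v" "\<And>x. x \<in> S \<Longrightarrow> x \<bullet> T x \<le> s * (norm x)\<^sup>2"
proof -
  have cont: "continuous_on (S \<inter> sphere 0 1) (\<lambda>x. x \<bullet> T x)"
    using linear_continuous_on[OF linear_conv_bounded_linear[THEN iffD1, OF lin]]
    by (intro continuous_intros)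
  have "compact (S \<inter> sphere 0 1)"
    by (simp add: S closed_Int_compact closed_subspace)
  moreover have "(1 / norm u) *\<^sub>R u \<in> S \<inter> sphere 0 1"
    using assms by (simp add: subspace_scale)
  ultimately obtain v where v: "v \<in> S" "norm v = 1"
    and max: "\<And>x. x \<in> S \<Longrightarrow> norm x = 1 \<Longrightarrow> x \<bullet> T x \<le> v \<bullet> T v"
    using continuous_attains_sup[OF _ _ cont] by fastforce
  define s where "s = v \<bullet> T v"
  have le: "x \<bullet> T x \<le> s * (norm x)\<^sup>2" if "x \<in> S" for x
  proof (cases "x = 0")
    case True
    then show ?thesis by simp
  next
    case False
    have "((1 / norm x) *\<^sub>R x) \<bullet> T ((1 / norm x) *\<^sub>R x) \<le> s"
      unfolding s_def using that False by (intro max) (auto simp: S subspace_scale)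
    then show ?thesis
      using False by (simp add: linear_scale[OF lin] power2_eq_square field_simps)
  qed
  define w where "w = s *\<^sub>R v - T v"
  have wS: "w \<in> S"
    unfolding w_def using v S inv by (simp add: subspace_diff subspace_scale)
  define c where "c = s * (norm w)\<^sup>2 - w \<bullet> T w"
  \<comment> \<open>The nonnegative form of \<open>s - T\<close> evaluated at
    \<open>v + h *\<^sub>R w\<close>: its constant term vanishes because \<open>v\<close> attains
    \<open>s\<close>, and \<open>c\<close> is its value at \<open>w\<close>.\<close>
  have q: "0 \<le> 2 * h * (norm w)\<^sup>2 + h\<^sup>2 * c" for h
  proof -
    have "v + h *\<^sub>R w \<in> S" using v wS S by (simp add: subspace_add subspace_scale)
    from le[OF this] have "0 \<le> s * ((v + h *\<^sub>R w) \<bullet> (v + h *\<^sub>R w)) - (v + h *\<^sub>R w) \<bullet> T (v + h *\<^sub>R w)"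
      by (simp add: power2_norm_eq_inner)
    also have "\<dots> = (s * (v \<bullet> v) - s) + 2 * h * (s * (v \<bullet> w) - T v \<bullet> w) + h\<^sup>2 * c"
      unfolding c_def s_def power2_norm_eq_inner
      by (simp add: linear_add[OF lin] linear_scale[OF lin] inner_simps power2_eq_square
          sa[of v w] inner_commute[of w v] inner_commute[of w "T v"] algebra_simps)
    also have "s * (v \<bullet> w) - T v \<bullet> w = (norm w)\<^sup>2"
      unfolding w_def power2_norm_eq_inner by (simp add: inner_simps inner_commute right_diff_distrib)
    also have "v \<bullet> v = 1" using v by (simp add: norm_eq_1)
    finally show ?thesis by simp
  qed
  have "w = 0"
  proof (rule ccontr)
    assume "w \<noteq> 0"
    define n where "n = (norm w)\<^sup>2"
    have n: "n > 0" using \<open>w \<noteq> 0\<close> by (simp add: n_def)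
    have c: "c \<ge> 0" unfolding c_def using le[OF wS] by simp
    \<comment> \<open>The test value is \<open>h = - d\<close>, small enough that the linear term
      beats the quadratic one. The extra \<open>n\<close> in the denominator covers
      \<open>c = 0\<close>.\<close>
    define d where "d = n / (c + n)"
    have d: "0 < d" "d * c \<le> n" using n c by (auto simp: d_def field_simps)
    have "0 \<le> d * (d * c - 2 * n)"
      using q[of "- d"] by (simp add: n_def power2_eq_square algebra_simps)
    then have "2 * n \<le> d * c" using d(1) by (simp add: zero_le_mult_iff)
    then show False using d(2) n by simp
  qed
  then have "T v = s *\<^sub>R v" by (simp add: w_def)
  then show thesis using that[of v s] v le by fastforce
qed

text \<open>This replaces the spectral theorem: the eigenspace of the largest eigenvalue of \<open>M\<close> is
  invariant under \<open>T\<close>, so it contains a common eigenvector.\<close>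

lemma commuting_selfadjoint_bound:
  fixes T M :: "'a::euclidean_space \<Rightarrow> 'a"
  assumes T: "linear T" "\<And>x y. x \<bullet> T y = T x \<bullet> y"
    and M: "linear M" "\<And>x y. x \<bullet> M y = M x \<bullet> y"
    and comm: "\<And>x. M (T x) = T (M x)"
    and le: "\<And>v l s. v \<noteq> 0 \<Longrightarrow> T v = l *\<^sub>R v \<Longrightarrow> M v = s *\<^sub>R v \<Longrightarrow> s \<le> c"
  shows "x \<bullet> M x \<le> c * (norm x)\<^sup>2"
proof (cases "x = 0")
  case True
  then show ?thesis by simp
next
  case False
  obtain v s where v: "v \<noteq> 0" "M v = s *\<^sub>R v" and s: "\<And>x. x \<bullet> M x \<le> s * (norm x)\<^sup>2"
    using selfadjoint_max_eigenvector[OF M subspace_UNIV _ _ False] by auto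
  let ?E = "{u. M u = s *\<^sub>R u}"
  have E: "subspace ?E"
    by (auto simp: subspace_def linear_add[OF M(1)] linear_scale[OF M(1)] linear_0[OF M(1)]
        scaleR_add_right)
  have inv: "T u \<in> ?E" if "u \<in> ?E" for u
    using that by (simp add: comm linear_scale[OF T(1)])
  have vE: "v \<in> ?E" using v(2) by simp
  obtain u l where "u \<in> ?E" "u \<noteq> 0" "T u = l *\<^sub>R u"
    using selfadjoint_max_eigenvector[OF T E inv vE v(1)] by blast
  then have "s \<le> c" using le by auto
  then show ?thesis using s[of x] by (meson mult_right_mono order_trans zero_le_power2)
qed

section \<open>Scaled Chebyshev polynomials of an operator\<close>

text \<open>For a number \<open>c\<close>, the operator \<open>(*) c\<close> gives \<open>2 * r ^ k\<close> times the value at \<open>c / r\<close> of the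
  Chebyshev polynomial of degree \<open>k\<close>; the scaling makes sense for \<open>r = 0\<close> as well.\<close>

fun scaled_cheb :: "real \<Rightarrow> ('a::real_vector \<Rightarrow> 'a) \<Rightarrow> nat \<Rightarrow> 'a \<Rightarrow> 'a" where
  "scaled_cheb r C 0 x = 2 *\<^sub>R x"
| "scaled_cheb r C (Suc 0) x = 2 *\<^sub>R C x"
| "scaled_cheb r C (Suc (Suc k)) x =
     2 *\<^sub>R C (scaled_cheb r C (Suc k) x) - r\<^sup>2 *\<^sub>R scaled_cheb r C k x"

lemma linear_scaled_cheb:
  assumes "linear C"
  shows "linear (scaled_cheb r C k)"
proof (induction k rule: induct_nat_012)
  case 0
  show ?case by (simp add: linear_iff algebra_simps)
next
  case 1
  show ?case using assms by (simp add: linear_iff algebra_simps)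
next
  case (ge2 k)
  then show ?case using assms by (simp add: linear_iff algebra_simps)
qed

lemma scaled_cheb_commute:
  assumes "linear C" "linear U" "\<And>x. U (C x) = C (U x)"
  shows "U (scaled_cheb r C k x) = scaled_cheb r C k (U x)"
  by (induction k rule: induct_nat_012)
    (simp_all add: linear_scale[OF assms(2)] linear_diff[OF assms(2)] assms(3))

lemma scaled_cheb_selfadjoint:
  fixes C :: "'a::real_inner \<Rightarrow> 'a"
  assumes lin: "linear C" and sa: "\<And>x y. x \<bullet> C y = C x \<bullet> y"
  shows "x \<bullet> scaled_cheb r C k y = scaled_cheb r C k x \<bullet> y"
proof (induction k arbitrary: x y rule: induct_nat_012)
  case (ge2 k)
  \<comment> \<open>The recursion puts \<open>C\<close> outermost, while moving both factors to the
    other side of the inner product puts it innermost.\<close>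
  have "C (scaled_cheb r C (Suc k) x) = scaled_cheb r C (Suc k) (C x)"
    by (rule scaled_cheb_commute[OF lin lin]) simp
  then show ?case using ge2 by (simp add: inner_simps sa)
qed (simp_all add: sa)

lemma scaled_cheb_eigenvector:
  assumes lin: "linear C" and "C v = c *\<^sub>R v"
  shows "scaled_cheb r C k v = scaled_cheb r ((*) c) k 1 *\<^sub>R v"
  by (induction k rule: induct_nat_012)
    (simp_all add: linear_scale[OF lin] assms(2) scaleR_left_diff_distrib mult_ac)

text \<open>With \<open>c = r * cos \<theta>\<close> the recursion becomes the addition formula of
  the cosine, so the value is \<open>2 * r ^ k * cos (k * \<theta>)\<close>.\<close>

lemma abs_scaled_cheb_le:
  assumes "\<bar>c\<bar> \<le> r"
  shows "\<bar>scaled_cheb r ((*) c) k 1\<bar> \<le> 2 * r ^ k"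
proof -
  obtain \<theta> where c: "c = r * cos \<theta>"
  proof (cases "r = 0")
    case False
    then show thesis using that[of "arccos (c / r)"] assms by (simp add: cos_arccos_abs)
  qed (use that[of 0] assms in simp)
  have cos_rec: "cos (real (Suc (Suc k)) * \<theta>) = 2 * cos \<theta> * cos (real (Suc k) * \<theta>) - cos (real k * \<theta>)" for k
  proof -
    have "real (Suc (Suc k)) * \<theta> = real (Suc k) * \<theta> + \<theta>" "real k * \<theta> = real (Suc k) * \<theta> - \<theta>"
      by (simp_all add: algebra_simps)
    then show ?thesis by (simp only: cos_add cos_diff) simp
  qed
  have "scaled_cheb r ((*) c) k 1 = 2 * r ^ k * cos (real k * \<theta>)"
  proof (induction k rule: induct_nat_012)
    case (ge2 k)
    show ?case
      by (simp only: scaled_cheb.simps ge2 cos_rec) (simp add: c power2_eq_square algebra_simps)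
  qed (simp_all add: c)
  then have "\<bar>scaled_cheb r ((*) c) k 1\<bar> = 2 * \<bar>r\<bar> ^ k * \<bar>cos (real k * \<theta>)\<bar>"
    by (simp add: abs_mult power_abs)
  also have "\<dots> \<le> 2 * \<bar>r\<bar> ^ k * 1"
    by (intro mult_left_mono) auto
  finally show ?thesis using assms by simp
qed

text \<open>The argument is the image of the origin under the affine map that takes the spectral
  interval to \<open>[-r, r]\<close>.\<close>

lemma scaled_cheb_at_origin:
  "scaled_cheb r ((*) ((1 + r\<^sup>2) / 2)) k 1 = 1 + r ^ (2 * k)"
  by (induction k rule: induct_nat_012) (simp_all add: power2_eq_square field_simps)

text \<open>Replacing \<open>T\<close> by zero turns \<open>C\<close> into multiplication by
  \<open>\<gamma>\<close>, so the subtracted multiple of \<open>x\<close> is the constant term of a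
  polynomial in \<open>T\<close> of degree \<open>k\<close>. What remains is a combination of
  \<open>T x\<close>, ..., \<open>T^k x\<close>, and \<open>S\<close> stands for the Krylov spaces
  started at \<open>T x\<close>.\<close>

lemma scaled_cheb_affine_mem:
  assumes lin: "linear C" and C: "\<And>x. C x = \<gamma> *\<^sub>R x - \<delta> *\<^sub>R T x" and "linear T"
    and S: "\<And>j. subspace (S j)" "\<And>j. S j \<subseteq> S (Suc j)" "T x \<in> S 1"
      "\<And>j u. u \<in> S j \<Longrightarrow> T u \<in> S (Suc j)"
  shows "scaled_cheb r C k x - scaled_cheb r ((*) \<gamma>) k 1 *\<^sub>R x \<in> S k"
proof (induction k rule: induct_nat_012)
  case 0
  show ?case using S(1) by (simp add: subspace_0)
next
  case 1
  have "scaled_cheb r C (Suc 0) x - scaled_cheb r ((*) \<gamma>) (Suc 0) 1 *\<^sub>R x = (- 2 * \<delta>) *\<^sub>R T x"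
    by (simp add: C scaleR_diff_right)
  also have "\<dots> \<in> S (Suc 0)" using S(3) by (intro subspace_scale[OF S(1)]) simp
  finally show ?case .
next
  case (ge2 k)
  define p where "p = scaled_cheb r ((*) \<gamma>) k 1"
  define q where "q = scaled_cheb r ((*) \<gamma>) (Suc k) 1"
  define u where "u = scaled_cheb r C k x - p *\<^sub>R x"
  define w where "w = scaled_cheb r C (Suc k) x - q *\<^sub>R x"
  have x1: "T x \<in> S (Suc (Suc k))"
    using S(2,3) lift_Suc_mono_le[of S 1 "Suc (Suc k)"] by auto
  have u: "u \<in> S (Suc (Suc k))" using ge2(1) S(2) unfolding u_def p_def by blast
  have w: "w \<in> S (Suc (Suc k))" "T w \<in> S (Suc (Suc k))"
    using ge2(2) S(2,4) unfolding w_def q_def by blast+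
  have eq: "scaled_cheb r C (Suc k) x = w + q *\<^sub>R x" "scaled_cheb r C k x = u + p *\<^sub>R x"
    by (simp_all add: u_def w_def)
  have "scaled_cheb r C (Suc (Suc k)) x - scaled_cheb r ((*) \<gamma>) (Suc (Suc k)) 1 *\<^sub>R x
    = (2 * \<gamma>) *\<^sub>R w - (2 * \<delta>) *\<^sub>R T w - (2 * \<delta> * q) *\<^sub>R T x - r\<^sup>2 *\<^sub>R u"
    unfolding scaled_cheb.simps p_def[symmetric] q_def[symmetric] eq C
    by (simp add: linear_add[OF \<open>linear T\<close>] linear_scale[OF \<open>linear T\<close>] algebra_simps)
  also have "\<dots> \<in> S (Suc (Suc k))"
    using x1 u w by (intro subspace_diff[OF S(1)] subspace_scale[OF S(1)])
  finally show ?case .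
qed

section \<open>The Galerkin approximation from a Krylov space\<close>

text \<open>The difference of the two sides is the quadratic form of a polynomial \<open>M\<close>
  in \<open>T\<close>, so only common eigenvectors have to be examined. There the claim follows from
  the Chebyshev bound together with \<open>1 \<le> l / a\<close>.\<close>

lemma scaled_cheb_energy_bound:
  fixes T :: "'a::euclidean_space \<Rightarrow> 'a"
  assumes T: "linear T" "\<And>x y. x \<bullet> T y = T x \<bullet> y"
    and "0 < a"
    and spec: "\<And>v l. v \<noteq> 0 \<Longrightarrow> T v = l *\<^sub>R v \<Longrightarrow> a \<le> l \<and> \<bar>c0 - c1 * l\<bar> \<le> r"
    and C: "C = (\<lambda>x. c0 *\<^sub>R x - c1 *\<^sub>R T x)"
  shows "scaled_cheb r C k x \<bullet> T (scaled_cheb r C k x) \<le> (2 * r ^ k)\<^sup>2 / a * (norm (T x))\<^sup>2"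
proof -
  let ?N = "scaled_cheb r C k"
  define M where "M = (\<lambda>x. T (?N (?N x)) - ((2 * r ^ k)\<^sup>2 / a) *\<^sub>R T (T x))"
  have linC: "linear C" unfolding C
    by (intro linear_compose_sub linear_compose_scale_right T(1) linear_id[unfolded id_def])
  have saC: "x \<bullet> C y = C x \<bullet> y" for x y
    unfolding C by (simp add: inner_simps T(2))
  have linN: "linear ?N" by (rule linear_scaled_cheb[OF linC])
  have saN: "x \<bullet> ?N y = ?N x \<bullet> y" for x y by (rule scaled_cheb_selfadjoint[OF linC saC])
  have comm: "T (?N x) = ?N (T x)" for x
    by (rule scaled_cheb_commute[OF linC T(1)])
      (simp add: C linear_diff[OF T(1)] linear_scale[OF T(1)])
  have "x \<bullet> M x \<le> 0 * (norm x)\<^sup>2"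
  proof (rule commuting_selfadjoint_bound[OF T])
    show "linear M" unfolding M_def
      using linear_compose[OF linear_compose[OF linN linN] T(1)] linear_compose[OF T(1) T(1)]
      by (intro linear_compose_sub linear_compose_scale_right) (auto simp: o_def)
    show "x \<bullet> M y = M x \<bullet> y" for x y
      unfolding M_def by (simp add: inner_simps T(2) saN comm)
    show "M (T x) = T (M x)" for x
      unfolding M_def by (simp add: linear_diff[OF T(1)] linear_scale[OF T(1)] comm)
    fix v l s assume v: "v \<noteq> 0" "T v = l *\<^sub>R v" "M v = s *\<^sub>R v"
    let ?d = "scaled_cheb r ((*) (c0 - c1 * l)) k 1"
    have l: "a \<le> l" "\<bar>c0 - c1 * l\<bar> \<le> r" using spec v by auto
    have "?N v = ?d *\<^sub>R v"
      by (rule scaled_cheb_eigenvector[OF linC]) (simp add: C v scaleR_left_diff_distrib)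
    then have "M v = (l * ?d\<^sup>2 - (2 * r ^ k)\<^sup>2 / a * l\<^sup>2) *\<^sub>R v"
      unfolding M_def
      by (simp add: linear_scale[OF linN] linear_scale[OF T(1)] v power2_eq_square
          scaleR_left_diff_distrib mult_ac)
    then have "s = l * ?d\<^sup>2 - (2 * r ^ k)\<^sup>2 / a * l\<^sup>2" using v by simp
    moreover have "l * ?d\<^sup>2 \<le> (2 * r ^ k)\<^sup>2 / a * l\<^sup>2"
    proof -
      have "?d\<^sup>2 \<le> (2 * r ^ k)\<^sup>2"
        using abs_scaled_cheb_le[OF l(2), of k] by (metis abs_ge_zero power2_abs power_mono)
      also have "\<dots> \<le> (2 * r ^ k)\<^sup>2 * (l / a)"
        using mult_left_mono[of 1 "l / a" "(2 * r ^ k)\<^sup>2"] l(1) \<open>0 < a\<close> by simp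
      finally have "l * ?d\<^sup>2 \<le> l * ((2 * r ^ k)\<^sup>2 * (l / a))"
        using l \<open>0 < a\<close> by (intro mult_left_mono) auto
      then show ?thesis by (simp add: power2_eq_square mult_ac)
    qed
    ultimately show "s \<le> 0" by simp
  qed
  then show ?thesis
    unfolding M_def by (simp add: inner_simps comm saN[symmetric] power2_norm_eq_inner T(2))
qed

text \<open>The error of a Galerkin approximation is minimal in the energy norm. The competitor is the
  error whose residual polynomial is the Chebyshev polynomial for \<open>[a, \<kappa> * a]\<close>, normalised at the
  origin.\<close>

lemma galerkin_error_bound:
  fixes T :: "'a::euclidean_space \<Rightarrow> 'a"
  assumes T: "linear T" "\<And>x y. x \<bullet> T y = T x \<bullet> y"
    and a: "0 < a" "\<And>x. a * (norm x)\<^sup>2 \<le> x \<bullet> T x"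
    and spec: "\<And>v l. v \<noteq> 0 \<Longrightarrow> T v = l *\<^sub>R v \<Longrightarrow> l \<le> \<kappa> * a"
    and "1 \<le> \<kappa>"
    and S: "\<And>j. subspace (S j)" "\<And>j. S j \<subseteq> S (Suc j)" "T x \<in> S 1"
      "\<And>j u. u \<in> S j \<Longrightarrow> T u \<in> S (Suc j)"
    and x: "x' \<in> S m" "\<And>u. u \<in> S m \<Longrightarrow> u \<bullet> T (x - x') = 0"
  shows "norm (x - x') \<le> 2 * ((sqrt \<kappa> - 1) / (sqrt \<kappa> + 1)) ^ m / a * norm (T x)"
proof -
  define q where "q = sqrt \<kappa>"
  define r where "r = (q - 1) / (q + 1)"
  have q: "1 \<le> q" "q\<^sup>2 = \<kappa>" using \<open>1 \<le> \<kappa>\<close> by (auto simp: q_def)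
  have r: "0 \<le> r" using q by (simp add: r_def)
  \<comment> \<open>\<open>c0\<close> and \<open>c1\<close> are fixed by sending the endpoints
    \<open>a\<close> and \<open>\<kappa> * a\<close> to \<open>r\<close> and \<open>- r\<close>. The
    origin then goes to \<open>c0\<close>.\<close>
  define c0 where "c0 = (1 + r\<^sup>2) / 2"
  define c1 where "c1 = 2 / (a * (1 + q)\<^sup>2)"
  define C where "C = (\<lambda>x. c0 *\<^sub>R x - c1 *\<^sub>R T x)"
  have linC: "linear C" unfolding C_def
    by (intro linear_compose_sub linear_compose_scale_right T(1) linear_id[unfolded id_def])
  have c0: "c0 = (1 + q\<^sup>2) / (1 + q)\<^sup>2"
  proof -
    have "(1 + q)\<^sup>2 * r\<^sup>2 = (q - 1)\<^sup>2"
      unfolding r_def power_divide using q(1) by (simp add: add.commute)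
    moreover have "2 * (c0 * (1 + q)\<^sup>2) = (1 + q)\<^sup>2 + (1 + q)\<^sup>2 * r\<^sup>2"
      by (simp add: c0_def distrib_right distrib_left)
    ultimately have "c0 * (1 + q)\<^sup>2 = 1 + q\<^sup>2"
      by (simp add: power2_eq_square algebra_simps)
    then show ?thesis using q(1) by (simp add: eq_divide_eq)
  qed
  have spec': "a \<le> l \<and> \<bar>c0 - c1 * l\<bar> \<le> r" if "v \<noteq> 0" "T v = l *\<^sub>R v" for v l
  proof -
    have "a * (norm v)\<^sup>2 \<le> l * (norm v)\<^sup>2" using a(2)[of v] that by (simp add: power2_norm_eq_inner)
    then have "a \<le> l" using that by simp
    have le: "l \<le> q\<^sup>2 * a" using spec that q by simp
    have "c0 - c1 * l = (a * (1 + q\<^sup>2) - 2 * l) / (a * (1 + q)\<^sup>2)"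
      unfolding c0 c1_def using a q by (simp add: field_simps)
    moreover have "r = (a * (q\<^sup>2 - 1)) / (a * (1 + q)\<^sup>2)"
    proof -
      have "a * (q\<^sup>2 - 1) = (a * (1 + q)) * (q - 1)" "a * (1 + q)\<^sup>2 = (a * (1 + q)) * (q + 1)"
        by (simp_all add: power2_eq_square algebra_simps)
      then show ?thesis unfolding r_def using a(1) q(1) by (simp only: mult_divide_mult_cancel_left_if) simp
    qed
    moreover have "\<bar>a * (1 + q\<^sup>2) - 2 * l\<bar> \<le> a * (q\<^sup>2 - 1)"
      using \<open>a \<le> l\<close> le by (auto simp: abs_le_iff algebra_simps)
    moreover have "0 < a * (1 + q)\<^sup>2" using a(1) q(1) by simp
    ultimately have "\<bar>c0 - c1 * l\<bar> \<le> r"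
      by (simp only: abs_divide abs_of_pos divide_right_mono less_imp_le)
    with \<open>a \<le> l\<close> show ?thesis by simp
  qed
  \<comment> \<open>The normalising value at the origin. Since it is at least 1, it is estimated
    away below, which leaves the constant 2.\<close>
  define D where "D = 1 + r ^ (2 * m)"
  have D: "1 \<le> D" using r by (simp add: D_def)
  define N where "N = scaled_cheb r C m x"
  have mem: "N - D *\<^sub>R x \<in> S m"
    using scaled_cheb_affine_mem[where C = C and \<gamma> = c0 and \<delta> = c1 and T = T and S = S and x = x
        and r = r and k = m, OF linC _ T(1) S]
    unfolding N_def D_def by (simp add: c0_def C_def scaled_cheb_at_origin)
  define e where "e = x - x'"
  define e' where "e' = (1 / D) *\<^sub>R N"
  have "e' - e = (1 / D) *\<^sub>R (N - D *\<^sub>R x) + x'"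
    unfolding e'_def e_def using D by (simp add: scaleR_diff_right)
  also have "\<dots> \<in> S m"
    using mem x by (intro subspace_add[OF S(1)] subspace_scale[OF S(1)])
  finally have u: "e' - e \<in> S m" .
  define u where "u = e' - e"
  have e': "e' = e + u" by (simp add: u_def)
  have "u \<bullet> T e = 0" using x(2) u by (simp add: u_def e_def)
  \<comment> \<open>Pythagoras in the energy norm: Galerkin orthogonality and the symmetry of
    \<open>T\<close> remove both mixed terms.\<close>
  then have "e' \<bullet> T e' = e \<bullet> T e + u \<bullet> T u"
    unfolding e' by (simp add: linear_add[OF T(1)] inner_simps T(2)[of e u] inner_commute)
  moreover have "0 \<le> u \<bullet> T u" using a(2)[of u] a(1) by (smt (verit) mult_nonneg_nonneg zero_le_power2)
  ultimately have "a * (norm e)\<^sup>2 \<le> e' \<bullet> T e'" using a(2)[of e] by linarith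
  also have "\<dots> = (1 / D)\<^sup>2 * (N \<bullet> T N)"
    by (simp add: e'_def linear_scale[OF T(1)] power2_eq_square)
  also have "\<dots> \<le> 1 * (N \<bullet> T N)"
  proof (rule mult_right_mono)
    show "(1 / D)\<^sup>2 \<le> 1" using D by (simp add: power_le_one)
    show "0 \<le> N \<bullet> T N" using a(2)[of N] a(1) by (smt (verit) mult_nonneg_nonneg zero_le_power2)
  qed
  also have "\<dots> \<le> (2 * r ^ m)\<^sup>2 / a * (norm (T x))\<^sup>2"
    unfolding N_def using scaled_cheb_energy_bound[OF T a(1) spec' C_def] by simp
  finally have "(norm e)\<^sup>2 \<le> (2 * r ^ m / a * norm (T x))\<^sup>2"
    using a(1) by (simp add: power_mult_distrib power_divide field_simps power2_eq_square)
  then have "norm e \<le> 2 * r ^ m / a * norm (T x)"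
    by (rule power2_le_imp_le) (use a r in simp)
  then show ?thesis by (simp add: e_def r_def q_def)
qed

section \<open>Complex vectors and matrices\<close>

lemma scaleR_eq_scalar_mult: "c *\<^sub>R (x :: complex^'n) = complex_of_real c *s x"
  by (simp add: vec_eq_iff) (simp add: scaleR_conv_of_real)

text \<open>The bridge to the real theory: a Hermitian matrix is selfadjoint for the real inner
  product, so the results on Euclidean spaces apply to it.\<close>

lemma inner_eq_Re_cinner: "x \<bullet> y = Re (cinner x y)"
  by (simp add: cinner_def inner_vec_def inner_complex_def)

lemma cinner_add_right: "cinner x (y + z) = cinner x y + cinner x z"
  and cinner_diff_right: "cinner x (y - z) = cinner x y - cinner x z"
  and cinner_scale_right: "cinner x (c *s y) = c * cinner x y"
  and cinner_zero_right [simp]: "cinner x 0 = 0"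
  and cinner_zero_left [simp]: "cinner 0 x = 0"
  by (simp_all add: cinner_def algebra_simps sum.distrib sum_subtractf sum_distrib_left)

lemma cinner_commute: "cinner y x = cnj (cinner x y)"
  by (simp add: cinner_def mult.commute)

lemma cinner_sum_right: "cinner x (sum f I) = (\<Sum>i\<in>I. cinner x (f i))"
  by (induction I rule: infinite_finite_induct) (simp_all add: cinner_add_right)

lemma cinner_self: "cinner x x = complex_of_real ((norm x)\<^sup>2)"
proof (rule complex_eqI)
  show "Re (cinner x x) = Re (complex_of_real ((norm x)\<^sup>2))"
    by (simp add: inner_eq_Re_cinner[symmetric] power2_norm_eq_inner)
  show "Im (cinner x x) = Im (complex_of_real ((norm x)\<^sup>2))"
    by (simp add: cinner_def mult.commute)
qed

lemma norm_cinner_le: "cmod (cinner x y) \<le> norm x * norm y"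
proof -
  have "cmod (cinner x y) \<le> (\<Sum>i\<in>UNIV. \<bar>cmod (x $ i)\<bar> * \<bar>cmod (y $ i)\<bar>)"
    unfolding cinner_def by (rule order_trans[OF norm_sum]) (simp add: norm_mult)
  also have "\<dots> \<le> norm x * norm y"
    unfolding norm_vec_def by (rule L2_set_mult_ineq)
  finally show ?thesis .
qed

lemma norm_scalar_mult: "norm (c *s x) = cmod c * norm (x :: complex^'n)"
  by (simp add: norm_vec_def norm_mult L2_set_right_distrib)

section \<open>Conjugate transposes, adjoints and scalar matrices\<close>

lemma ctranspose_ctranspose [simp]: "ctranspose (ctranspose M) = M"
  by (simp add: ctranspose_def vec_eq_iff)

lemma ctranspose_mult: "ctranspose (M ** N) = ctranspose N ** ctranspose M"
  by (simp add: ctranspose_def matrix_matrix_mult_def vec_eq_iff mult.commute)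

lemma ctranspose_add: "ctranspose (M + N) = ctranspose M + ctranspose N"
  by (simp add: ctranspose_def vec_eq_iff)

lemma ctranspose_mat [simp]: "ctranspose (mat c) = mat (cnj c)"
  by (auto simp: ctranspose_def mat_def vec_eq_iff)

lemma cinner_adjoint: "cinner x (M *v y) = cinner (ctranspose M *v x) y"
proof -
  have "cinner x (M *v y) = (\<Sum>i\<in>UNIV. \<Sum>j\<in>UNIV. cnj (x $ i) * M $ i $ j * y $ j)"
    by (simp add: cinner_def matrix_vector_mult_def sum_distrib_left mult.assoc)
  also have "\<dots> = (\<Sum>j\<in>UNIV. \<Sum>i\<in>UNIV. cnj (x $ i) * M $ i $ j * y $ j)"
    by (rule sum.swap)
  also have "\<dots> = cinner (ctranspose M *v x) y"
    by (simp add: cinner_def matrix_vector_mult_def ctranspose_def sum_distrib_left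
        sum_distrib_right mult_ac)
  finally show ?thesis .
qed

lemma inner_adjoint: "x \<bullet> (M *v y) = (ctranspose M *v x) \<bullet> y" for x :: "complex^'n"
  by (simp add: inner_eq_Re_cinner cinner_adjoint)

lemma outer_mult_vector: "outer x y *v u = cinner y u *s x"
  by (simp add: outer_def cinner_def matrix_vector_mult_def vec_eq_iff sum_distrib_left mult_ac)

lemma mat_of_real: "mat (complex_of_real c) = c *\<^sub>R mat 1"
  by (simp add: mat_def vec_eq_iff) (simp add: scaleR_conv_of_real)

lemma mat_mult_vector: "mat c *v x = c *s (x :: complex^'n)"
proof -
  have "(\<Sum>j\<in>UNIV. (if i = j then c else 0) * x $ j) = c * x $ i" for i
    by (subst sum.cong[OF refl, of _ _ "\<lambda>j. if i = j then c * x $ j else 0"]) auto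
  then show ?thesis by (simp add: mat_def matrix_vector_mult_def vec_eq_iff)
qed

lemma scaleR_matrix_vector: "(c *\<^sub>R M) *v x = c *\<^sub>R (M *v x)" for M :: "complex^'n^'m"
  by (simp add: matrix_vector_mult_def vec_eq_iff scaleR_right.sum)

section \<open>Bilinearity of the matrix products and the Frobenius norm\<close>

lemma bounded_bilinear_matrix_mult:
  "bounded_bilinear ((**) :: complex^'n^'m \<Rightarrow> complex^'p^'n \<Rightarrow> complex^'p^'m)"
proof -
  have "bilinear ((**) :: complex^'n^'m \<Rightarrow> complex^'p^'n \<Rightarrow> complex^'p^'m)"
    unfolding bilinear_def linear_iff
    by (auto simp: matrix_matrix_mult_def vec_eq_iff algebra_simps sum.distrib scaleR_right.sum)
  then show ?thesis by (simp add: bilinear_conv_bounded_bilinear)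
qed

lemma bounded_bilinear_matrix_vector:
  "bounded_bilinear ((*v) :: complex^'n^'m \<Rightarrow> complex^'n \<Rightarrow> complex^'m)"
proof -
  have "bilinear ((*v) :: complex^'n^'m \<Rightarrow> complex^'n \<Rightarrow> complex^'m)"
    unfolding bilinear_def linear_iff
    by (auto simp: matrix_vector_mult_def vec_eq_iff algebra_simps sum.distrib scaleR_right.sum)
  then show ?thesis by (simp add: bilinear_conv_bounded_bilinear)
qed

lemma matrix_vector_scaleR: "M *v (c *\<^sub>R x) = c *\<^sub>R (M *v x)" for M :: "complex^'n^'m"
  by (rule bounded_bilinear.scaleR_right[OF bounded_bilinear_matrix_vector])

lemma norm_matrix_vector_le: "norm (M *v x) \<le> norm M * norm x" for M :: "complex^'n^'m"
proof -
  have "norm ((M *v x) $ i) \<le> norm (M $ i) * norm x" for i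
  proof -
    have "norm ((M *v x) $ i) \<le> (\<Sum>j\<in>UNIV. \<bar>cmod (M $ i $ j)\<bar> * \<bar>cmod (x $ j)\<bar>)"
      unfolding matrix_vector_mult_def vec_lambda_beta
      by (rule order_trans[OF norm_sum]) (simp add: norm_mult)
    also have "\<dots> \<le> norm (M $ i) * norm x"
      unfolding norm_vec_def by (rule L2_set_mult_ineq)
    finally show ?thesis .
  qed
  then have "norm (M *v x) \<le> L2_set (\<lambda>i. norm (M $ i) * norm x) UNIV"
    unfolding norm_vec_def[of "M *v x"] by (intro L2_set_mono) auto
  also have "\<dots> = norm M * norm x"
    by (simp add: norm_vec_def[of M] L2_set_left_distrib)
  finally show ?thesis .
qed

lemma norm_axis_complex [simp]: "norm (axis j 1 :: complex^'n) = 1"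
  by (simp add: norm_eq_sqrt_inner inner_axis_axis inner_complex_def)

text \<open>Each entry is bounded by applying the matrix to a unit vector. The dimension factor is
  crude but harmless: the bound serves only continuity, integrability and differentiability, never
  the final estimate.\<close>

lemma norm_matrix_le:
  fixes M :: "complex^'n^'m"
  assumes "\<And>x. norm (M *v x) \<le> c * norm x"
  shows "norm M \<le> real (CARD('m) * CARD('n)) * c"
proof -
  have entry: "cmod (M $ i $ j) \<le> c" for i j
  proof -
    have "cmod (M $ i $ j) = norm ((M *v axis j 1) $ i)"
      by (simp add: matrix_vector_mult_def axis_def if_distrib cong: if_cong)
    also have "\<dots> \<le> norm (M *v axis j 1)" by (rule Finite_Cartesian_Product.norm_nth_le)
    also have "\<dots> \<le> c" using assms[of "axis j 1"] by simp
    finally show ?thesis .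
  qed
  have "norm M \<le> (\<Sum>i\<in>UNIV. norm (M $ i))"
    unfolding norm_vec_def[of M] by (rule L2_set_le_sum) simp
  also have "\<dots> \<le> (\<Sum>i\<in>UNIV. \<Sum>j\<in>UNIV. cmod (M $ i $ j))"
    unfolding norm_vec_def[of "M $ _"] by (intro sum_mono L2_set_le_sum) simp
  also have "\<dots> \<le> (\<Sum>i\<in>(UNIV :: 'm set). \<Sum>j\<in>(UNIV :: 'n set). c)"
    by (intro sum_mono entry)
  finally show ?thesis by simp
qed

section \<open>Coercive matrices and their resolvents\<close>

lemma matrix_inv_unique:
  assumes "M ** N = mat 1" "N ** M = mat 1"
  shows "matrix_inv M = N"
  unfolding matrix_inv_def
proof (rule some_equality)
  fix N' assume "M ** N' = mat 1 \<and> N' ** M = mat 1"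
  then show "N' = N" by (metis assms matrix_mul_assoc matrix_mul_lid matrix_mul_rid)
qed (use assms in blast)

lemma invertible_matrix_inv:
  assumes "invertible M"
  shows "M ** matrix_inv M = mat 1" "matrix_inv M ** M = mat 1"
proof -
  have "\<exists>N. M ** N = mat 1 \<and> N ** M = mat 1" using assms by (simp add: invertible_def)
  then have "M ** matrix_inv M = mat 1 \<and> matrix_inv M ** M = mat 1"
    unfolding matrix_inv_def by (rule someI_ex)
  then show "M ** matrix_inv M = mat 1" "matrix_inv M ** M = mat 1" by auto
qed

text \<open>The resolvent identity. It serves both for continuity in the shift \<open>t\<close> and
  for the derivative with respect to the matrix.\<close>

lemma matrix_inv_diff:
  fixes M N :: "complex^'n^'n"
  assumes "invertible M" "invertible N"
  shows "matrix_inv M - matrix_inv N = matrix_inv M ** (N - M) ** matrix_inv N"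
proof -
  note bilinear = bounded_bilinear.diff_left[OF bounded_bilinear_matrix_mult]
    bounded_bilinear.diff_right[OF bounded_bilinear_matrix_mult]
  have "matrix_inv M ** (N - M) ** matrix_inv N
      = matrix_inv M ** (N ** matrix_inv N) - (matrix_inv M ** M) ** matrix_inv N"
    by (simp add: bilinear matrix_mul_assoc)
  then show ?thesis by (simp add: invertible_matrix_inv assms)
qed

text \<open>A lower bound for the Hermitian part. It survives small perturbations in arbitrary, also
  non-Hermitian, directions, as the Frechet derivative requires, and passes to compressions with the
  same constant.\<close>

definition coercive :: "real \<Rightarrow> complex^'n^'n \<Rightarrow> bool" where
  "coercive a M \<longleftrightarrow> (\<forall>x. a * (norm x)\<^sup>2 \<le> x \<bullet> (M *v x))"

lemma coercive_add_mat:
  assumes "coercive a M"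
  shows "coercive (a + t) (M + mat (complex_of_real t))"
  using assms unfolding coercive_def
  by (auto simp: mat_of_real matrix_vector_mult_add_rdistrib scaleR_matrix_vector inner_add_right
      power2_norm_eq_inner distrib_right)

lemma coercive_perturb:
  assumes "coercive a M" "norm E \<le> e"
  shows "coercive (a - e) (M + E)"
  unfolding coercive_def
proof
  fix x
  have "\<bar>x \<bullet> (E *v x)\<bar> \<le> norm x * (norm E * norm x)"
    by (rule order_trans[OF Cauchy_Schwarz_ineq2]) (intro mult_left_mono norm_matrix_vector_le, simp)
  also have "\<dots> \<le> norm x * (e * norm x)"
    using assms(2) by (intro mult_left_mono mult_right_mono) auto
  finally have "- (e * (norm x)\<^sup>2) \<le> x \<bullet> (E *v x)" by (simp add: power2_eq_square mult_ac)
  moreover have "a * (norm x)\<^sup>2 \<le> x \<bullet> (M *v x)" using assms(1) by (simp add: coercive_def)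
  ultimately show "(a - e) * (norm x)\<^sup>2 \<le> x \<bullet> ((M + E) *v x)"
    by (simp add: matrix_vector_mult_add_rdistrib inner_add_right left_diff_distrib)
qed

lemma norm_orthonormal_mult:
  fixes V :: "complex^'m^'n"
  assumes "ctranspose V ** V = mat 1"
  shows "norm (V *v x) = norm x"
  by (simp add: norm_eq_sqrt_inner inner_adjoint[of "V *v x" V] matrix_vector_mul_assoc assms)

lemma coercive_compression:
  fixes V :: "complex^'m^'n"
  assumes "coercive a M" and V: "ctranspose V ** V = mat 1"
  shows "coercive a (ctranspose V ** M ** V)"
  unfolding coercive_def
proof
  fix x
  have "a * (norm x)\<^sup>2 = a * (norm (V *v x))\<^sup>2" by (simp add: norm_orthonormal_mult[OF V])
  also have "\<dots> \<le> (V *v x) \<bullet> (M *v (V *v x))" using assms(1) by (simp add: coercive_def)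
  also have "\<dots> = x \<bullet> ((ctranspose V ** M ** V) *v x)"
    by (simp add: inner_adjoint[of x] ctranspose_mult matrix_vector_mul_assoc[symmetric]
        inner_adjoint[of "V *v x"])
  finally show "a * (norm x)\<^sup>2 \<le> x \<bullet> ((ctranspose V ** M ** V) *v x)" .
qed

lemma coercive_invertible:
  assumes "coercive a M" "0 < a"
  shows "invertible M"
proof -
  have "x = 0" if "M *v x = 0" for x
  proof -
    have "a * (norm x)\<^sup>2 \<le> 0" using assms(1) that unfolding coercive_def by (metis inner_zero_right)
    then show ?thesis using assms(2) by (simp add: mult_le_0_iff)
  qed
  then obtain N where "N ** M = mat 1" using matrix_left_invertible_ker[of M] by blast
  then show ?thesis unfolding invertible_left_inverse by blast
qed

text \<open>The Lax-Milgram argument: test \<open>M *v u = x\<close> against \<open>u\<close> and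
  apply Cauchy-Schwarz.\<close>

lemma norm_matrix_inv_mult_le:
  assumes "coercive a M" "0 < a"
  shows "norm (matrix_inv M *v x) \<le> norm x / a"
proof -
  define u where "u = matrix_inv M *v x"
  have "M *v u = x"
    by (simp add: u_def matrix_vector_mul_assoc invertible_matrix_inv coercive_invertible[OF assms])
  then have "a * (norm u)\<^sup>2 \<le> u \<bullet> x" using assms(1) unfolding coercive_def by metis
  also have "\<dots> \<le> norm u * norm x" by (rule norm_cauchy_schwarz)
  finally have "norm u * (a * norm u) \<le> norm u * norm x" by (simp add: power2_eq_square mult_ac)
  then have "a * norm u \<le> norm x" by (cases "u = 0") auto
  then show ?thesis using assms(2) by (simp add: u_def field_simps)
qed

section \<open>Resolvents along the half line\<close>

abbreviation resolvent :: "complex^'n^'n \<Rightarrow> real \<Rightarrow> complex^'n^'n" where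
  "resolvent M t \<equiv> matrix_inv (M + mat (complex_of_real t))"

lemma invertible_add_mat:
  assumes "coercive a M" "0 < a" "0 \<le> t"
  shows "invertible (M + mat (complex_of_real t))"
  using coercive_invertible[OF coercive_add_mat[OF assms(1)]] assms by (simp add: add_pos_nonneg)

lemma norm_resolvent_mult_le:
  assumes "coercive a M" "0 < a" "0 \<le> t"
  shows "norm (resolvent M t *v x) \<le> norm x / (a + t)"
  using norm_matrix_inv_mult_le[OF coercive_add_mat[OF assms(1)]] assms by (simp add: add_pos_nonneg)

text \<open>Converts the natural decay of a resolvent into the majorant that Stieltjes functions
  provide.\<close>

lemma inverse_shift_le:
  fixes a t :: real
  assumes "0 < a" "0 \<le> t"
  shows "1 / (a + t) \<le> 1 / min a 1 / (1 + t)"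
proof -
  have "min a 1 * (1 + t) \<le> a * 1 + 1 * t"
    unfolding distrib_left using assms by (intro add_mono mult_right_mono) auto
  then show ?thesis using assms by (simp add: frac_le)
qed

text \<open>The constant is chosen before \<open>M\<close>, so a single bound holds for all matrices
  near a given one.\<close>

lemma norm_resolvent_le:
  fixes a :: real
  assumes "0 < a"
  obtains c where "0 \<le> c"
    "\<And>(M :: complex^'n^'n) t. coercive a M \<Longrightarrow> 0 \<le> t \<Longrightarrow> norm (resolvent M t) \<le> c / (1 + t)"
proof
  let ?c = "real (CARD('n) * CARD('n)) * (1 / min a 1)"
  show "0 \<le> ?c" using assms by simp
  fix M :: "complex^'n^'n" and t :: real assume *: "coercive a M" "0 \<le> t"
  have "norm (resolvent M t) \<le> real (CARD('n) * CARD('n)) * (1 / (a + t))"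
    using norm_resolvent_mult_le[OF *(1) assms *(2)] by (intro norm_matrix_le) simp
  also have "\<dots> \<le> real (CARD('n) * CARD('n)) * (1 / min a 1 / (1 + t))"
    using inverse_shift_le[OF assms *(2)] by (intro mult_left_mono) auto
  finally show "norm (resolvent M t) \<le> ?c / (1 + t)" by simp
qed

text \<open>By the resolvent identity the resolvent is Lipschitz in \<open>t\<close>, because it is
  bounded on the half line.\<close>

lemma continuous_on_resolvent:
  fixes M :: "complex^'n^'n"
  assumes M: "coercive a M" and "0 < a"
  shows "continuous_on {0..} (resolvent M)"
proof -
  obtain c where c: "0 \<le> c" and
    "\<And>(M :: complex^'n^'n) t. coercive a M \<Longrightarrow> 0 \<le> t \<Longrightarrow> norm (resolvent M t) \<le> c / (1 + t)"
    using norm_resolvent_le[OF \<open>0 < a\<close>] by blast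
  then have "norm (resolvent M t) \<le> c / (1 + t)" if "0 \<le> t" for t using M that by blast
  moreover have "c / (1 + t) \<le> c" if "0 \<le> t" for t
    using that c mult_left_mono[of 1 "1 + t" c] by (simp add: divide_le_eq)
  ultimately have le: "norm (resolvent M t) \<le> c" if "0 \<le> t" for t using that by fastforce
  obtain K where K: "0 < K" "\<And>(X :: complex^'n^'n) (Y :: complex^'n^'n). norm (X ** Y) \<le> norm X * norm Y * K"
    using bounded_bilinear.pos_bounded[OF bounded_bilinear_matrix_mult] by blast
  have "(c * c * K)-lipschitz_on {0..} (resolvent M)"
  proof (rule lipschitz_onI)
    fix t s :: real assume ts: "t \<in> {0..}" "s \<in> {0..}"
    have "resolvent M t - resolvent M s
        = resolvent M t ** (mat (complex_of_real s) - mat (complex_of_real t)) ** resolvent M s"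
      using ts by (simp add: matrix_inv_diff invertible_add_mat[OF M \<open>0 < a\<close>])
    also have "\<dots> = (s - t) *\<^sub>R (resolvent M t ** resolvent M s)"
      unfolding mat_of_real scaleR_diff_left[symmetric]
        bounded_bilinear.scaleR_right[OF bounded_bilinear_matrix_mult]
        bounded_bilinear.scaleR_left[OF bounded_bilinear_matrix_mult]
      by simp
    finally have "norm (resolvent M t - resolvent M s) = \<bar>s - t\<bar> * norm (resolvent M t ** resolvent M s)"
      by simp
    also have "\<dots> \<le> \<bar>s - t\<bar> * (norm (resolvent M t) * norm (resolvent M s) * K)"
      by (intro mult_left_mono K) simp
    also have "\<dots> \<le> \<bar>s - t\<bar> * (c * c * K)"
      using ts K(1) c by (intro mult_left_mono mult_right_mono mult_mono le) auto
    finally show "dist (resolvent M t) (resolvent M s) \<le> (c * c * K) * dist t s"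
      by (simp add: dist_norm mult_ac abs_minus_commute)
  qed (use c K(1) in simp)
  then show ?thesis by (rule lipschitz_on_continuous_on)
qed

section \<open>Integrals of resolvents\<close>

text \<open>With the half line as the whole space, set integrals become plain ones and
  \<open>0 \<le> t\<close> holds at every point of the space.\<close>

locale half_line_measure =
  fixes N :: "real measure"
  assumes sets_eq: "sets N = sets (restrict_space borel {0..})"
    and integrable_inverse: "integrable N (\<lambda>t. 1 / (1 + t))"
begin

lemma space_eq [simp]: "space N = {0..}"
  using sets_eq_imp_space_eq[OF sets_eq] by (simp add: space_restrict_space)

lemma integrable_decay:
  fixes g :: "real \<Rightarrow> 'b::{banach, second_countable_topology}"
  assumes "continuous_on {0..} g" "\<And>t. 0 \<le> t \<Longrightarrow> norm (g t) \<le> c / (1 + t)"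
  shows "integrable N g"
proof (rule Bochner_Integration.integrable_bound)
  show "integrable N (\<lambda>t. c * (1 / (1 + t)))"
    using integrable_inverse by (rule integrable_mult_right)
  show "g \<in> borel_measurable N"
    using borel_measurable_continuous_on_restrict[OF assms(1)] by (simp cong: measurable_cong_sets add: sets_eq)
  have "norm (g t) \<le> norm (c * (1 / (1 + t)))" if "0 \<le> t" for t
    using order_trans[OF assms(2)[OF that] abs_ge_self] by simp
  then show "AE t in N. norm (g t) \<le> norm (c * (1 / (1 + t)))"
    by (intro AE_I2) simp
qed

lemma integrable_inverse_shift:
  assumes "0 < a"
  shows "integrable N (\<lambda>t. 1 / (a + t))"
proof (rule integrable_decay)
  show "continuous_on {0..} (\<lambda>t. 1 / (a + t))"
    using assms by (intro continuous_intros) auto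
  show "norm (1 / (a + t)) \<le> 1 / min a 1 / (1 + t)" if "0 \<le> t" for t
    using inverse_shift_le[OF assms that] assms that by simp
qed

lemma integrable_inverse_shift_square:
  assumes "0 < a"
  shows "integrable N (\<lambda>t. 1 / (a + t)\<^sup>2)"
proof (rule integrable_decay)
  show "continuous_on {0..} (\<lambda>t. 1 / (a + t)\<^sup>2)"
    using assms by (intro continuous_intros) auto
  show "norm (1 / (a + t)\<^sup>2) \<le> 1 / a * (1 / min a 1) / (1 + t)" if "0 \<le> t" for t
  proof -
    have "norm (1 / (a + t)\<^sup>2) = 1 / (a + t) * (1 / (a + t))"
      using that assms by (simp add: power2_eq_square)
    also have "\<dots> \<le> 1 / a * (1 / min a 1 / (1 + t))"
      using inverse_shift_le[OF assms that] assms that by (intro mult_mono) (auto simp: frac_le)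
    finally show ?thesis by simp
  qed
qed

lemma integrable_resolvent:
  assumes "coercive a M" "0 < a"
  shows "integrable N (resolvent M)"
  using norm_resolvent_le[OF assms(2)] continuous_on_resolvent[OF assms] assms(1)
  by (metis integrable_decay)

text \<open>The first resolvent supplies the decay \<open>1 / (1 + t)\<close>; the second is
  estimated by a constant.\<close>

lemma integrable_resolvent_product:
  fixes M :: "complex^'n^'n" and M' :: "complex^'p^'p" and E :: "complex^'p^'n"
  assumes M: "coercive a M" and M': "coercive a M'" and a: "0 < a"
  shows "integrable N (\<lambda>t. resolvent M t ** E ** resolvent M' t)"
proof -
  obtain c where c: "0 \<le> c" "\<And>(M :: complex^'n^'n) t. coercive a M \<Longrightarrow> 0 \<le> t \<Longrightarrow> norm (resolvent M t) \<le> c / (1 + t)"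
    using norm_resolvent_le[OF a] by blast
  obtain d where d: "0 \<le> d" "\<And>(M :: complex^'p^'p) t. coercive a M \<Longrightarrow> 0 \<le> t \<Longrightarrow> norm (resolvent M t) \<le> d / (1 + t)"
    using norm_resolvent_le[OF a] by blast
  obtain K where K: "0 < K" "\<And>(X :: complex^'n^'n) (Y :: complex^'p^'n). norm (X ** Y) \<le> norm X * norm Y * K"
    using bounded_bilinear.pos_bounded[OF bounded_bilinear_matrix_mult] by blast
  obtain L where L: "0 < L" "\<And>(X :: complex^'p^'n) (Y :: complex^'p^'p). norm (X ** Y) \<le> norm X * norm Y * L"
    using bounded_bilinear.pos_bounded[OF bounded_bilinear_matrix_mult] by blast
  show ?thesis
  proof (rule integrable_decay)
    show "continuous_on {0..} (\<lambda>t. resolvent M t ** E ** resolvent M' t)"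
      by (intro bounded_bilinear.continuous_on[OF bounded_bilinear_matrix_mult]
          continuous_on_resolvent[OF M a] continuous_on_resolvent[OF M' a] continuous_on_const)
    fix t :: real assume t: "0 \<le> t"
    have d': "norm (resolvent M' t) \<le> d"
      using d(2)[OF M' t] d(1) t by (smt (verit) divide_le_eq mult_left_mono mult_cancel_left2)
    have "norm (resolvent M t ** E ** resolvent M' t) \<le> (c / (1 + t) * norm E * K) * d * L"
      using K(1) L(1) c(1) t
      by (intro order_trans[OF L(2)] mult_right_mono mult_mono d' order_trans[OF K(2)] c(2) M) auto
    then show "norm (resolvent M t ** E ** resolvent M' t) \<le> (c * norm E * K * d * L) / (1 + t)"
      by simp
  qed
qed

text \<open>Differentiation under the integral sign. The pointwise remainder is quadratic in
  \<open>h\<close> with an integrable factor, so its integral is \<open>O((norm h)^2)\<close>. The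
  lemma is used for the matrix function as well as for the scalar function.\<close>

lemma has_derivative_integral:
  fixes \<phi> :: "'a::euclidean_space \<Rightarrow> real \<Rightarrow> 'b::{banach, second_countable_topology}"
  assumes "0 < e"
    and int: "\<And>h. norm h \<le> e \<Longrightarrow> integrable N (\<phi> (x + h))"
    and lin: "\<And>t. 0 \<le> t \<Longrightarrow> linear (D t)"
    and intD: "\<And>h. integrable N (\<lambda>t. D t h)"
    and rem: "\<And>h t. norm h \<le> e \<Longrightarrow> 0 \<le> t \<Longrightarrow>
      norm (\<phi> (x + h) t - \<phi> x t - D t h) \<le> g t * (norm h)\<^sup>2"
    and intg: "integrable N g"
  shows "((\<lambda>x. \<integral>t. \<phi> x t \<partial>N) has_derivative (\<lambda>h. \<integral>t. D t h \<partial>N)) (at x)"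
  unfolding has_derivative_at
proof
  have "linear (\<lambda>h. \<integral>t. D t h \<partial>N)"
    unfolding linear_iff
  proof safe
    fix h k c
    have "(\<integral>t. D t (h + k) \<partial>N) = (\<integral>t. D t h + D t k \<partial>N)"
      by (intro Bochner_Integration.integral_cong refl linear_add lin) simp
    then show "(\<integral>t. D t (h + k) \<partial>N) = (\<integral>t. D t h \<partial>N) + (\<integral>t. D t k \<partial>N)"
      by (simp add: intD)
    have "(\<integral>t. D t (c *\<^sub>R h) \<partial>N) = (\<integral>t. c *\<^sub>R D t h \<partial>N)"
      by (intro Bochner_Integration.integral_cong refl linear_scale lin) simp
    then show "(\<integral>t. D t (c *\<^sub>R h) \<partial>N) = c *\<^sub>R (\<integral>t. D t h \<partial>N)" by simp
  qed
  then show "bounded_linear (\<lambda>h. \<integral>t. D t h \<partial>N)" by (simp add: linear_conv_bounded_linear)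
  show "(\<lambda>h. norm ((\<integral>t. \<phi> (x + h) t \<partial>N) - (\<integral>t. \<phi> x t \<partial>N) - (\<integral>t. D t h \<partial>N)) / norm h) \<midarrow>0\<rightarrow> 0"
  proof (rule Lim_null_comparison)
    show "((\<lambda>h. (\<integral>t. g t \<partial>N) * norm h) \<longlongrightarrow> 0) (at 0)"
      by (rule tendsto_eq_intros tendsto_norm_zero tendsto_ident_at refl | simp)+
    have "norm (norm ((\<integral>t. \<phi> (x + h) t \<partial>N) - (\<integral>t. \<phi> x t \<partial>N) - (\<integral>t. D t h \<partial>N)) / norm h)
        \<le> (\<integral>t. g t \<partial>N) * norm h" if h: "h \<noteq> 0" "norm h \<le> e" for h
    proof -
      have "(\<integral>t. \<phi> (x + h) t \<partial>N) - (\<integral>t. \<phi> x t \<partial>N) - (\<integral>t. D t h \<partial>N)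
          = (\<integral>t. \<phi> (x + h) t - \<phi> x t - D t h \<partial>N)"
        using int[OF h(2)] int[of 0] \<open>0 < e\<close> intD[of h] by simp
      also have "norm \<dots> \<le> (\<integral>t. g t * (norm h)\<^sup>2 \<partial>N)"
        using int[OF h(2)] int[of 0] \<open>0 < e\<close> intD[of h] intg rem[OF h(2)]
        by (intro Bochner_Integration.integral_norm_bound_integral) auto
      finally show ?thesis using h by (simp add: field_simps power2_eq_square)
    qed
    then show "\<forall>\<^sub>F h in at 0. norm (norm ((\<integral>t. \<phi> (x + h) t \<partial>N) - (\<integral>t. \<phi> x t \<partial>N) - (\<integral>t. D t h \<partial>N)) / norm h)
        \<le> (\<integral>t. g t \<partial>N) * norm h"
      using \<open>0 < e\<close> by (auto simp: eventually_at intro!: exI[of _ e])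
  qed
qed

lemma has_derivative_integral_resolvent:
  fixes A :: "complex^'n^'n"
  assumes A: "coercive a A" and a: "0 < a"
  shows "((\<lambda>M. \<integral>t. resolvent M t \<partial>N) has_derivative
    (\<lambda>E. \<integral>t. - (resolvent A t ** E ** resolvent A t) \<partial>N)) (at A)"
proof -
  note bilinear = bounded_bilinear.diff_left[OF bounded_bilinear_matrix_mult]
    bounded_bilinear.diff_right[OF bounded_bilinear_matrix_mult]
    bounded_bilinear.minus_left[OF bounded_bilinear_matrix_mult]
    bounded_bilinear.minus_right[OF bounded_bilinear_matrix_mult]
    bounded_bilinear.add_left[OF bounded_bilinear_matrix_mult]
    bounded_bilinear.add_right[OF bounded_bilinear_matrix_mult]
    bounded_bilinear.scaleR_left[OF bounded_bilinear_matrix_mult]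
    bounded_bilinear.scaleR_right[OF bounded_bilinear_matrix_mult]
  \<comment> \<open>Perturbations of norm at most \<open>a / 2\<close> leave the coercivity constant
    \<open>a / 2\<close>, so all resolvents involved share one bound.\<close>
  have a2: "0 < a / 2" using a by simp
  obtain c where c: "0 \<le> c" "\<And>(M :: complex^'n^'n) t. coercive (a / 2) M \<Longrightarrow> 0 \<le> t \<Longrightarrow> norm (resolvent M t) \<le> c / (1 + t)"
    using norm_resolvent_le[OF a2] by blast
  have c': "norm (resolvent M t) \<le> c" if "coercive (a / 2) M" "0 \<le> t" for M :: "complex^'n^'n" and t
    using c(2)[OF that] c(1) that(2) by (smt (verit) divide_le_eq mult_left_mono mult_cancel_left2)
  obtain K where K: "0 < K" "\<And>(X :: complex^'n^'n) (Y :: complex^'n^'n). norm (X ** Y) \<le> norm X * norm Y * K"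
    using bounded_bilinear.pos_bounded[OF bounded_bilinear_matrix_mult] by blast
  have near: "coercive (a / 2) (A + E)" if "norm E \<le> a / 2" for E
    using coercive_perturb[OF A that] by simp
  show ?thesis
  proof (rule has_derivative_integral[OF a2])
    show "integrable N (resolvent (A + E))" if "norm E \<le> a / 2" for E
      using near[OF that] a2 by (rule integrable_resolvent)
    show "linear (\<lambda>E. - (resolvent A t ** E ** resolvent A t))" for t
      unfolding linear_iff by (simp add: bilinear)
    show "integrable N (\<lambda>t. - (resolvent A t ** E ** resolvent A t))" for E
      using integrable_resolvent_product[OF A A a] by simp
    show "integrable N (\<lambda>t. (c * c * c * K ^ 4) * (1 / (1 + t)))"
      using integrable_inverse by (rule integrable_mult_right)
    fix E :: "complex^'n^'n" and t :: real assume E: "norm E \<le> a / 2" and t: "0 \<le> t"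
    define R where "R = resolvent A t"
    define R' where "R' = resolvent (A + E) t"
    have A2: "coercive (a / 2) A" using near[of 0] a by simp
    have inv: "invertible (A + mat (complex_of_real t))" "invertible (A + E + mat (complex_of_real t))"
      using invertible_add_mat[OF A2 a2 t] invertible_add_mat[OF near[OF E] a2 t] by auto
    have eq: "R - R' = R ** E ** R'"
      using matrix_inv_diff[OF inv] by (simp add: R_def R'_def)
    have "R' - R = - (R ** E ** R')" using eq by (simp add: algebra_simps)
    \<comment> \<open>Using the resolvent identity a second time gives the remainder
      \<open>R E R E R'\<close>. The last factor keeps the decay in \<open>t\<close>, the others are
      bounded by constants.\<close>
    then have "R' - R - (- (R ** E ** R)) = R ** E ** (R - R')" by (simp add: bilinear)
    also have "\<dots> = (R ** E) ** ((R ** E) ** R')" by (simp only: eq)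
    also have "norm \<dots> \<le> (c * norm E * K) * ((c * norm E * K) * (c / (1 + t)) * K) * K"
    proof -
      have RE: "norm (R ** E) \<le> c * norm E * K"
        unfolding R_def using K(1) c(1)
        by (intro order_trans[OF K(2)] mult_right_mono mult_mono c'[OF A2 t]) auto
      have "norm R' \<le> c / (1 + t)" unfolding R'_def by (rule c(2)[OF near[OF E] t])
      then show ?thesis
        using K(1) c(1) t
        by (intro order_trans[OF K(2)] mult_right_mono mult_mono RE) auto
    qed
    also have "\<dots> = (c * c * c * K ^ 4) * (1 / (1 + t)) * (norm E)\<^sup>2"
      by (simp add: power2_eq_square power4_eq_xxxx mult_ac)
    finally show "norm (resolvent (A + E) t - resolvent A t - - (resolvent A t ** E ** resolvent A t))
        \<le> (c * c * c * K ^ 4) * (1 / (1 + t)) * (norm E)\<^sup>2"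
      by (simp add: R_def R'_def)
  qed
qed

lemma has_field_derivative_integral_inverse:
  assumes a: "0 < a"
  shows "((\<lambda>z. \<integral>t. 1 / (z + complex_of_real t) \<partial>N) has_field_derivative
    - complex_of_real (\<integral>t. 1 / (a + t)\<^sup>2 \<partial>N)) (at (complex_of_real a))"
proof -
  have a2: "0 < a / 2" using a by simp
  \<comment> \<open>The shifted denominators stay away from zero uniformly in \<open>h\<close>; this
    is the scalar counterpart of the perturbed coercivity.\<close>
  have near: "a / 2 + t \<le> cmod (complex_of_real a + h + complex_of_real t)"
    if "norm h \<le> a / 2" "0 \<le> t" for h t
  proof -
    have "a + t = cmod (complex_of_real a + h + complex_of_real t - h)"
      using a that by (simp add: norm_of_real[of "a + t", where ?'a = complex, simplified])
    also have "\<dots> \<le> cmod (complex_of_real a + h + complex_of_real t) + cmod h"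
      by (rule norm_triangle_ineq4)
    finally show ?thesis using that by simp
  qed
  have "((\<lambda>z. \<integral>t. 1 / (z + complex_of_real t) \<partial>N) has_derivative
    (\<lambda>h. \<integral>t. - complex_of_real (1 / (a + t)\<^sup>2) * h \<partial>N)) (at (complex_of_real a))"
  proof (rule has_derivative_integral[OF a2])
    show "integrable N (\<lambda>t. 1 / (complex_of_real a + h + complex_of_real t))" if h: "norm h \<le> a / 2" for h
    proof (rule integrable_decay)
      have "complex_of_real a + h + complex_of_real t \<noteq> 0" if "0 \<le> t" for t
        using near[OF h that] a2 that by force
      then show "continuous_on {0..} (\<lambda>t. 1 / (complex_of_real a + h + complex_of_real t))"
        by (intro continuous_intros) auto
      fix t :: real assume t: "0 \<le> t"
      have "norm (1 / (complex_of_real a + h + complex_of_real t)) \<le> 1 / (a / 2 + t)"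
        using near[OF h t] a2 t by (simp add: norm_divide frac_le)
      also have "\<dots> \<le> 1 / min (a / 2) 1 / (1 + t)" by (rule inverse_shift_le[OF a2 t])
      finally show "norm (1 / (complex_of_real a + h + complex_of_real t)) \<le> 1 / min (a / 2) 1 / (1 + t)" .
    qed
    show "linear (\<lambda>h. - complex_of_real (1 / (a + t)\<^sup>2) * h)" for t
      unfolding linear_iff by (simp add: scaleR_conv_of_real algebra_simps add_divide_distrib)
    show "integrable N (\<lambda>t. - complex_of_real (1 / (a + t)\<^sup>2) * h)" for h
      using integrable_inverse_shift_square[OF a]
      by (intro integrable_mult_left integrable_minus integrable_of_real) auto
    show "integrable N (\<lambda>t. 1 / a\<^sup>2 * (1 / (a / 2 + t)))"
      using integrable_inverse_shift[OF a2] by (rule integrable_mult_right)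
    fix h :: complex and t :: real assume h: "norm h \<le> a / 2" and t: "0 \<le> t"
    define w where "w = complex_of_real (a + t)"
    have w: "w \<noteq> 0" "cmod w = a + t" "complex_of_real a + complex_of_real t = w"
      using a t unfolding w_def by (simp_all del: of_real_add) simp
    have wh: "w + h \<noteq> 0" "a / 2 + t \<le> cmod (w + h)"
      using near[OF h t] a2 t by (auto simp: w_def add_ac)
    \<comment> \<open>The first-order Taylor remainder of the reciprocal in closed form. In the
      denominator \<open>w^2\<close> is bounded below by \<open>a^2\<close> in modulus, and
      \<open>w + h\<close> keeps the decay in \<open>t\<close>.\<close>
    have "1 / (w + h) - 1 / w + 1 / w\<^sup>2 * h = h\<^sup>2 / (w\<^sup>2 * (w + h))"
    proof -
      have "1 / v - 1 / w + 1 / w\<^sup>2 * (v - w) = (v - w)\<^sup>2 / (w\<^sup>2 * v)" if "v \<noteq> 0" for v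
        using w(1) that by (simp add: field_simps power2_eq_square)
      from this[OF wh(1)] show ?thesis by simp
    qed
    then have "norm (1 / (w + h) - 1 / w + 1 / w\<^sup>2 * h) = (cmod h)\<^sup>2 / ((a + t)\<^sup>2 * cmod (w + h))"
      by (simp add: norm_divide norm_mult norm_power w)
    also have "\<dots> \<le> (cmod h)\<^sup>2 / (a\<^sup>2 * (a / 2 + t))"
      using a a2 t wh by (intro divide_left_mono mult_mono power_mono mult_pos_pos) auto
    finally show "norm (1 / (complex_of_real a + h + complex_of_real t) - 1 / (complex_of_real a + complex_of_real t)
        - - complex_of_real (1 / (a + t)\<^sup>2) * h) \<le> 1 / a\<^sup>2 * (1 / (a / 2 + t)) * (norm h)\<^sup>2"
      by (simp add: w_def add_ac)
  qed
  then show ?thesis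
    unfolding has_field_derivative_def
    by (rule has_derivative_eq_rhs)
      (simp add: fun_eq_iff integral_complex_of_real[symmetric] del: integral_complex_of_real of_real_divide of_real_power)
qed

text \<open>The norm inequality for Bochner integrals is applied to \<open>F t *v x\<close> for
  fixed \<open>x\<close>, since on matrices it would concern the Frobenius norm.\<close>

lemma norm2_integral_le:
  fixes F :: "real \<Rightarrow> complex^'n^'m"
  assumes F: "integrable N F" and g: "integrable N g"
    and le: "\<And>t x. 0 \<le> t \<Longrightarrow> norm (F t *v x) \<le> g t * norm x"
  shows "norm2 (\<integral>t. F t \<partial>N) \<le> (\<integral>t. g t \<partial>N)"
  unfolding norm2_def
proof (rule onorm_bound)
  have "0 \<le> g t" if "0 \<le> t" for t
    using order_trans[OF norm_ge_zero le[OF that, of "axis undefined 1"]] by simp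
  then show "0 \<le> (\<integral>t. g t \<partial>N)" by (intro integral_nonneg_AE AE_I2) simp
  fix x :: "complex^'n"
  have bl: "bounded_linear (\<lambda>M :: complex^'n^'m. M *v x)"
    by (rule bounded_bilinear.bounded_linear_left[OF bounded_bilinear_matrix_vector])
  have "norm ((\<integral>t. F t \<partial>N) *v x) = norm (\<integral>t. F t *v x \<partial>N)"
    by (simp add: integral_bounded_linear[OF bl F])
  also have "\<dots> \<le> (\<integral>t. g t * norm x \<partial>N)"
    using g integrable_bounded_linear[OF bl F] le by (intro Bochner_Integration.integral_norm_bound_integral) auto
  also have "\<dots> = (\<integral>t. g t \<partial>N) * norm x" by simp
  finally show "norm ((\<integral>t. F t \<partial>N) *v x) \<le> (\<integral>t. g t \<partial>N) * norm x" .
qed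

end

section \<open>Block matrices\<close>

lemma sum_UNIV_sum_type:
  "(\<Sum>i\<in>(UNIV :: ('a::finite + 'b::finite) set). f i) = (\<Sum>i\<in>UNIV. f (Inl i)) + (\<Sum>i\<in>UNIV. f (Inr i))"
  by (simp add: UNIV_Plus_UNIV[symmetric] sum.Plus del: UNIV_Plus_UNIV)

lemma block_matrix_mult:
  "block_matrix P Q R S ** block_matrix P' Q' R' S' =
    block_matrix (P ** P' + Q ** R') (P ** Q' + Q ** S') (R ** P' + S ** R') (R ** Q' + S ** S')"
  by (simp add: vec_eq_iff block_matrix_def matrix_matrix_mult_def sum_UNIV_sum_type split: sum.split)

lemma block_matrix_add:
  "block_matrix P Q R S + block_matrix P' Q' R' S' = block_matrix (P + P') (Q + Q') (R + R') (S + S')"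
  by (simp add: vec_eq_iff block_matrix_def split: sum.split)

lemma block_matrix_mat: "block_matrix (mat c) 0 0 (mat c) = mat c"
  by (simp add: vec_eq_iff block_matrix_def mat_def split: sum.split)

lemma block12_block_matrix [simp]: "block12 (block_matrix P Q R S) = Q"
  by (simp add: vec_eq_iff block_matrix_def block12_def)

lemma bounded_linear_block12: "bounded_linear block12"
  by (simp add: linear_conv_bounded_linear[symmetric] linear_iff block12_def vec_eq_iff)

lemma bounded_linear_block_matrix:
  "bounded_linear (\<lambda>P. block_matrix P 0 0 0)"
  "bounded_linear (\<lambda>Q. block_matrix 0 Q 0 0)"
  "bounded_linear (\<lambda>S. block_matrix 0 0 0 S)"
  by (simp_all add: linear_conv_bounded_linear[symmetric] linear_iff block_matrix_def vec_eq_iff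
      split: sum.split)

lemma matrix_inv_block_matrix:
  fixes P S :: "complex^'m^'m"
  assumes "invertible P" "invertible S"
  shows "matrix_inv (block_matrix P Q 0 S)
    = block_matrix (matrix_inv P) (- (matrix_inv P ** Q ** matrix_inv S)) 0 (matrix_inv S)"
proof -
  note bilinear = bounded_bilinear.minus_left[OF bounded_bilinear_matrix_mult]
    bounded_bilinear.minus_right[OF bounded_bilinear_matrix_mult]
    bounded_bilinear.zero_left[OF bounded_bilinear_matrix_mult]
    bounded_bilinear.zero_right[OF bounded_bilinear_matrix_mult]
  have "P ** (matrix_inv P ** Q ** matrix_inv S) = Q ** matrix_inv S"
    by (simp add: matrix_mul_assoc invertible_matrix_inv assms)
  moreover have "matrix_inv P ** Q ** matrix_inv S ** S = matrix_inv P ** Q"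
    by (simp add: matrix_mul_assoc[symmetric] invertible_matrix_inv assms)
  ultimately show ?thesis
    by (intro matrix_inv_unique)
      (simp_all add: block_matrix_mult bilinear invertible_matrix_inv assms block_matrix_mat)
qed

text \<open>For large \<open>Q\<close> the block matrix need not be coercive, so its resolvent is
  shown integrable block by block, as the sum \<open>F\<close>. Only then may \<open>block12\<close>
  pass under the integral.\<close>

lemma (in half_line_measure) block12_integral_resolvent:
  assumes G: "coercive a G" and H: "coercive a H" and a: "0 < a"
  shows "block12 (\<integral>t. resolvent (block_matrix G Q 0 H) t \<partial>N)
    = (\<integral>t. - (resolvent G t ** Q ** resolvent H t) \<partial>N)"
proof -
  define F where "F t = block_matrix (resolvent G t) 0 0 0
    + block_matrix 0 (- (resolvent G t ** Q ** resolvent H t)) 0 0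
    + block_matrix 0 0 0 (resolvent H t)" for t
  have F: "resolvent (block_matrix G Q 0 H) t = F t" if "0 \<le> t" for t
    using matrix_inv_block_matrix[OF invertible_add_mat[OF G a that] invertible_add_mat[OF H a that], of Q]
    by (simp add: F_def block_matrix_mat[symmetric] block_matrix_add)
  have "integrable N F"
    unfolding F_def
    using integrable_resolvent[OF G a] integrable_resolvent[OF H a] integrable_resolvent_product[OF G H a]
    by (intro Bochner_Integration.integrable_add integrable_bounded_linear[OF bounded_linear_block_matrix(1)]
        integrable_bounded_linear[OF bounded_linear_block_matrix(2)]
        integrable_bounded_linear[OF bounded_linear_block_matrix(3)] integrable_minus) auto
  have "(\<integral>t. resolvent (block_matrix G Q 0 H) t \<partial>N) = (\<integral>t. F t \<partial>N)"
    by (intro Bochner_Integration.integral_cong) (auto simp: F)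
  also have "block12 \<dots> = (\<integral>t. block12 (F t) \<partial>N)"
    by (rule integral_bounded_linear[OF bounded_linear_block12 \<open>integrable N F\<close>, symmetric])
  finally show ?thesis by (simp add: F_def block_matrix_add)
qed

section \<open>Stieltjes functions as integrals over the half line\<close>

abbreviation half_line_restriction :: "(real \<Rightarrow> real) \<Rightarrow> real measure" where
  "half_line_restriction \<mu> \<equiv> restrict_space (stieltjes_measure \<mu>) {0..}"

lemma sets_stieltjes_measure [simp]: "sets (stieltjes_measure \<mu>) = sets borel"
  by (simp add: stieltjes_measure_def)

lemma set_integral_stieltjes_measure:
  fixes g :: "real \<Rightarrow> 'b::{banach, second_countable_topology}"
  shows "(LINT t:{0..}|stieltjes_measure \<mu>. g t) = (\<integral>t. g t \<partial>half_line_restriction \<mu>)"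
  by (simp add: set_lebesgue_integral_def integral_restrict_space)

lemma half_line_measure_restriction:
  assumes "stieltjes_function f \<mu>"
  shows "half_line_measure (half_line_restriction \<mu>)"
proof
  show "sets (half_line_restriction \<mu>) = sets (restrict_space borel {0..})"
    by (rule sets_restrict_space_cong) simp
  show "integrable (half_line_restriction \<mu>) (\<lambda>t. 1 / (1 + t))"
    using assms by (simp add: stieltjes_function_def set_integrable_def integrable_restrict_space)
qed

lemma deriv_stieltjes_function:
  assumes f: "stieltjes_function f \<mu>" and a: "0 < a"
  shows "deriv f (complex_of_real a) = - complex_of_real (\<integral>t. 1 / (a + t)\<^sup>2 \<partial>half_line_restriction \<mu>)"
proof (rule DERIV_imp_deriv)
  interpret half_line_measure "half_line_restriction \<mu>" by (rule half_line_measure_restriction[OF f])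
  show "(f has_field_derivative - complex_of_real (\<integral>t. 1 / (a + t)\<^sup>2 \<partial>half_line_restriction \<mu>))
      (at (complex_of_real a))"
  \<comment> \<open>The integral formula for \<open>f\<close> holds off the closed negative
    half-axis, whose complement is an open neighbourhood of \<open>a\<close>.\<close>
  proof (rule has_field_derivative_transform_within_open[OF has_field_derivative_integral_inverse[OF a]])
    show "open (- \<real>\<^sub>\<le>\<^sub>0 :: complex set)" by (simp add: open_Compl)
    show "complex_of_real a \<in> - \<real>\<^sub>\<le>\<^sub>0" using a by simp
    show "(\<integral>t. 1 / (z + complex_of_real t) \<partial>half_line_restriction \<mu>) = f z" if "z \<in> - \<real>\<^sub>\<le>\<^sub>0" for z
      using f that by (simp add: stieltjes_function_def set_integral_stieltjes_measure)
  qed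
qed

section \<open>The Arnoldi process\<close>

abbreviation arnoldi_space :: "complex^'n^'n \<Rightarrow> complex^'n \<Rightarrow> nat \<Rightarrow> (complex^'n) set" where
  "arnoldi_space A y j \<equiv> vec.span (arnoldi A y ` {..<j})"

text \<open>Krylov spaces are complex spans, whereas the Galerkin bound asks for real
  subspaces.\<close>

lemma vec_subspace_imp_subspace: "vec.subspace S \<Longrightarrow> subspace S" for S :: "(complex^'n) set"
  by (simp add: vec.subspace_def subspace_def scaleR_eq_scalar_mult)

lemma arnoldi_space_mono: "i \<le> j \<Longrightarrow> arnoldi_space A y i \<subseteq> arnoldi_space A y j"
  by (intro vec.span_mono image_mono) auto

text \<open>If the process breaks down at step \<open>j\<close>, then \<open>arnoldi A y (Suc j)\<close> is zero and the
  statement still holds.\<close>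

lemma mult_arnoldi_mem: "A *v arnoldi A y j \<in> arnoldi_space A y (Suc (Suc j))"
proof -
  define u where "u = A *v arnoldi A y j"
  define w where "w = u - (\<Sum>i\<le>j. cinner (arnoldi A y i) u *s arnoldi A y i)"
  have "arnoldi A y (Suc j) = (1 / norm w) *\<^sub>R w"
    by (simp add: Let_def u_def w_def)
  then have "w = complex_of_real (norm w) *s arnoldi A y (Suc j)"
    by (simp add: scaleR_eq_scalar_mult[symmetric])
  then have w: "w \<in> arnoldi_space A y (Suc (Suc j))"
    by (metis image_eqI lessI lessThan_iff vec.span_base vec.span_scale)
  have "(\<Sum>i\<le>j. cinner (arnoldi A y i) u *s arnoldi A y i) \<in> arnoldi_space A y (Suc (Suc j))"
    by (intro vec.span_sum vec.span_scale vec.span_base) auto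
  from vec.span_add[OF w this] show ?thesis by (simp add: w_def u_def)
qed

lemma mult_arnoldi_space_mem:
  assumes "x \<in> arnoldi_space A y j"
  shows "A *v x \<in> arnoldi_space A y (Suc j)"
  using assms
proof (induction rule: vec.span_induct_alt)
  case base
  show ?case by (simp add: vec.span_zero)
next
  case (step c x z)
  then obtain i where i: "x = arnoldi A y i" "i < j" by auto
  have "A *v x \<in> arnoldi_space A y (Suc j)"
    using mult_arnoldi_mem[of A y i] arnoldi_space_mono[of "Suc (Suc i)" "Suc j" A y] i by auto
  then show ?case
    using step by (simp add: matrix_vector_right_distrib vector_scalar_commute vec.span_add vec.span_scale)
qed

lemma start_mem_arnoldi_space: "y \<in> arnoldi_space A y (Suc 0)"
proof -
  \<comment> \<open>This includes \<open>y = 0\<close>, where both sides are zero.\<close>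
  have "y = complex_of_real (norm y) *s arnoldi A y 0"
    by (simp add: scaleR_eq_scalar_mult[symmetric])
  then show ?thesis
    by (metis image_eqI lessI lessThan_iff vec.span_base vec.span_scale)
qed

lemma krylov_subset_arnoldi_space: "krylov A y m \<subseteq> arnoldi_space A y m"
proof -
  have "((*v) A ^^ k) y \<in> arnoldi_space A y (Suc k)" for k
    by (induction k) (use start_mem_arnoldi_space mult_arnoldi_space_mem in auto)
  then have "((*v) A ^^ k) y \<in> arnoldi_space A y m" if "k < m" for k
    using that arnoldi_space_mono[of "Suc k" m A y] by auto
  then show ?thesis
    unfolding krylov_def by (intro vec.span_minimal vec.subspace_span) auto
qed

text \<open>No breakdown before step \<open>m\<close>: with a zero vector among them, the first
  \<open>m\<close> Arnoldi vectors would leave at most \<open>m - 1\<close> generators for a space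
  of dimension \<open>m\<close>.\<close>

lemma arnoldi_nonzero:
  assumes "vec.dim (krylov A y m) = m" "j < m"
  shows "arnoldi A y j \<noteq> 0"
proof
  assume zero: "arnoldi A y j = 0"
  let ?W = "arnoldi A y ` ({..<m} - {j})"
  have "arnoldi A y ` {..<m} = insert 0 ?W" using zero assms(2) by (auto simp: image_iff)
  then have "krylov A y m \<subseteq> vec.span ?W"
    using krylov_subset_arnoldi_space[of A y m] by (simp add: vec.span_insert_0)
  then have "m \<le> card ?W" using vec.dim_le_card[of "krylov A y m" ?W] assms(1) by simp
  also have "\<dots> \<le> card ({..<m} - {j})" by (rule card_image_le) simp
  also have "\<dots> < m" using assms(2) by simp
  finally show False by simp
qed

section \<open>Orthonormality of the Arnoldi vectors\<close>

lemma norm_arnoldi: "arnoldi A y j \<noteq> 0 \<Longrightarrow> norm (arnoldi A y j) = 1"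
  by (cases j) (auto simp: Let_def)

lemma arnoldi_orthogonal_less: "i < j \<Longrightarrow> cinner (arnoldi A y i) (arnoldi A y j) = 0"
proof (induction j arbitrary: i rule: less_induct)
  case (less j)
  then obtain k where j: "j = Suc k" by (cases j) auto
  let ?q = "arnoldi A y"
  define u where "u = A *v ?q k"
  define w where "w = u - (\<Sum>l\<le>k. cinner (?q l) u *s ?q l)"
  have i: "i \<le> k" using less.prems j by simp
  have "cinner (?q i) (?q l) = 0" if "l \<le> k" "l \<noteq> i" for l
  proof (cases "i < l")
    case True
    then show ?thesis using less.IH[of l i] that j by simp
  next
    case False
    then have "cinner (?q l) (?q i) = 0" using less.IH[of i l] that i j by simp
    then show ?thesis by (simp add: cinner_commute[of _ "?q l"])
  qed
  then have "(\<Sum>l\<le>k. cinner (?q l) u * cinner (?q i) (?q l))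
      = (\<Sum>l\<le>k. if l = i then cinner (?q i) u * cinner (?q i) (?q i) else 0)"
    by (intro sum.cong) auto
  also have "\<dots> = cinner (?q i) u * cinner (?q i) (?q i)" using i by simp
  \<comment> \<open>After a breakdown \<open>?q i\<close> may be zero, and then both sides vanish;
    otherwise it is a unit vector.\<close>
  also have "\<dots> = cinner (?q i) u"
    using norm_arnoldi[of A y i] by (cases "?q i = 0") (auto simp: cinner_self)
  finally have "cinner (?q i) w = 0"
    unfolding w_def by (simp add: cinner_diff_right cinner_sum_right cinner_scale_right)
  moreover have "?q j = (1 / norm w) *\<^sub>R w"
    by (simp add: j Let_def u_def w_def)
  ultimately show ?case by (simp only: scaleR_eq_scalar_mult cinner_scale_right) simp
qed

lemma arnoldi_orthogonal: "i \<noteq> j \<Longrightarrow> cinner (arnoldi A y i) (arnoldi A y j) = 0"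
  using arnoldi_orthogonal_less[of i j A y] arnoldi_orthogonal_less[of j i A y]
    cinner_commute[of "arnoldi A y i" "arnoldi A y j"]
  by (cases i j rule: linorder_cases) auto

section \<open>From step numbers to the column index type\<close>

abbreviation position :: "'m::{finite,linorder} \<Rightarrow> nat" where
  "position j \<equiv> card {i. i < j}"

lemma position_less: "position (j :: 'm::{finite,linorder}) < CARD('m)"
  by (intro psubset_card_mono) auto

lemma inj_position: "inj (position :: 'm::{finite,linorder} \<Rightarrow> nat)"
proof -
  have "strict_mono (position :: 'm \<Rightarrow> nat)"
    by (intro strict_monoI psubset_card_mono) (auto dest: less_trans)
  then show ?thesis by (rule strict_mono_imp_inj_on)
qed

lemma range_position: "range (position :: 'm::{finite,linorder} \<Rightarrow> nat) = {..<CARD('m)}"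
proof (rule card_subset_eq)
  show "range (position :: 'm \<Rightarrow> nat) \<subseteq> {..<CARD('m)}" using position_less by auto
  show "card (range (position :: 'm \<Rightarrow> nat)) = card {..<CARD('m)}"
    by (simp add: card_image inj_position)
qed simp

lemma arnoldi_basis_mult_axis: "arnoldi_basis A y *v axis j 1 = arnoldi A y (position j)"
  by (simp add: vec_eq_iff arnoldi_basis_def matrix_vector_mult_def axis_def if_distrib cong: if_cong)

lemma arnoldi_basis_mult: "arnoldi_basis A y *v c = (\<Sum>j\<in>UNIV. c $ j *s arnoldi A y (position j))"
  by (simp add: vec_eq_iff arnoldi_basis_def matrix_vector_mult_def mult.commute)

lemma range_arnoldi_basis:
  fixes V :: "complex^('m::{finite,linorder})^'n"
  assumes V: "V = arnoldi_basis A y"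
  shows "range ((*v) V) = arnoldi_space A y CARD('m)"
proof
  show "range ((*v) V) \<subseteq> arnoldi_space A y CARD('m)"
  proof safe
    fix c
    show "V *v c \<in> arnoldi_space A y CARD('m)"
      unfolding V arnoldi_basis_mult
      by (intro vec.span_sum vec.span_scale vec.span_base imageI) (simp add: position_less)
  qed
  show "arnoldi_space A y CARD('m) \<subseteq> range ((*v) V)"
  proof (rule vec.span_minimal)
    show "arnoldi A y ` {..<CARD('m)} \<subseteq> range ((*v) V)"
      unfolding range_position[symmetric, where 'm = 'm] by (auto simp: V arnoldi_basis_mult_axis[symmetric])
    show "vec.subspace (range ((*v) V))"
      unfolding vec.subspace_def
    proof safe
      show "0 \<in> range ((*v) V)" by (metis matrix_vector_mult_0_right rangeI)
      show "V *v u + V *v w \<in> range ((*v) V)" for u w by (metis matrix_vector_right_distrib rangeI)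
      show "c *s (V *v u) \<in> range ((*v) V)" for c u by (metis vector_scalar_commute rangeI)
    qed
  qed
qed

lemma arnoldi_basis_orthonormal:
  fixes V :: "complex^('m::{finite,linorder})^'n"
  assumes "vec.dim (krylov A y CARD('m)) = CARD('m)" and V: "V = arnoldi_basis A y"
  shows "ctranspose V ** V = mat 1"
proof -
  have "cinner (arnoldi A y (position i)) (arnoldi A y (position j)) = (if i = j then 1 else 0)"
    for i j :: 'm
  proof (cases "i = j")
    case True
    then show ?thesis
      using norm_arnoldi[OF arnoldi_nonzero[OF assms(1) position_less]] by (simp add: cinner_self)
  next
    case False
    then show ?thesis using arnoldi_orthogonal inj_position by (metis injD)
  qed
  then show ?thesis
    by (simp add: vec_eq_iff mat_def matrix_matrix_mult_def ctranspose_def V arnoldi_basis_def cinner_def)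
qed

lemma position_Min: "position (Min UNIV :: 'm::{finite,linorder}) = 0"
proof -
  have "\<not> i < Min UNIV" for i :: 'm
    by (metis Min_le finite UNIV_I not_less)
  then show ?thesis by (simp only: empty_def[symmetric] card.empty)
qed

lemma arnoldi_basis_mult_unit1: "norm y = 1 \<Longrightarrow> arnoldi_basis A y *v unit1 = y"
  by (simp add: unit1_def arnoldi_basis_mult_axis position_Min del: Min_gr_iff)

section \<open>Eigenvalues of Hermitian positive definite matrices\<close>

text \<open>Gives \<open>Min\<close> in \<open>smallest_eigenvalue\<close> its meaning: eigenvectors
  for distinct eigenvalues are orthogonal, hence independent.\<close>

lemma finite_real_eigenvalues:
  fixes A :: "complex^'n^'n"
  assumes A: "ctranspose A = A"
  shows "finite {l. eigenvalue A (complex_of_real l)}"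
proof -
  let ?E = "{l. eigenvalue A (complex_of_real l)}"
  have "\<forall>l\<in>?E. \<exists>v. v \<noteq> 0 \<and> A *v v = l *\<^sub>R v"
    by (auto simp: eigenvalue_def scaleR_eq_scalar_mult)
  then obtain v where v: "\<And>l. l \<in> ?E \<Longrightarrow> v l \<noteq> 0" "\<And>l. l \<in> ?E \<Longrightarrow> A *v v l = l *\<^sub>R v l"
    by metis
  have orth: "v k \<bullet> v l = 0" if "k \<in> ?E" "l \<in> ?E" "k \<noteq> l" for k l
  proof -
    have "l * (v k \<bullet> v l) = v k \<bullet> (A *v v l)" using v that by simp
    also have "\<dots> = (A *v v k) \<bullet> v l" by (simp add: inner_adjoint A)
    also have "\<dots> = k * (v k \<bullet> v l)" using v that by simp
    finally show ?thesis using that by simp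
  qed
  have "inj_on v ?E"
    using orth v(1) by (intro inj_onI) (metis inner_eq_zero_iff)
  moreover have "pairwise orthogonal (v ` ?E)"
    using orth by (auto simp: pairwise_def orthogonal_def)
  then have "independent (v ` ?E)"
    using v(1) by (intro pairwise_orthogonal_independent) auto
  then have "finite (v ` ?E)" by (rule finiteI_independent)
  ultimately show ?thesis by (simp add: finite_image_iff)
qed

lemma smallest_eigenvalue_hermitian_pos_def:
  fixes A :: "complex^'n^'n"
  assumes A: "hermitian_pos_def A"
  shows "eigenvalue A (complex_of_real (smallest_eigenvalue A))"
    and "0 < smallest_eigenvalue A"
    and "coercive (smallest_eigenvalue A) A"
proof -
  let ?E = "{l. eigenvalue A (complex_of_real l)}" and ?a = "smallest_eigenvalue A"
  have herm: "ctranspose A = A" using A by (simp add: hermitian_pos_def_def)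
  have fin: "finite ?E" by (rule finite_real_eigenvalues[OF herm])
  \<comment> \<open>Maximising the Rayleigh quotient of the negated matrix yields the minimum
    \<open>- s\<close> of that of \<open>A\<close>, attained at an eigenvector.\<close>
  have lin: "linear (\<lambda>x. - (A *v x))"
    by (intro linear_compose_neg) simp
  have sa: "x \<bullet> (- (A *v y)) = (- (A *v x)) \<bullet> y" for x y
    by (simp add: inner_adjoint herm)
  have "(axis undefined 1 :: complex^'n) \<noteq> 0" by simp
  from selfadjoint_max_eigenvector[OF lin sa subspace_UNIV _ _ this]
  obtain v s where v: "v \<noteq> 0" "- (A *v v) = s *\<^sub>R v"
    and s: "\<And>x. x \<bullet> (- (A *v x)) \<le> s * (norm x)\<^sup>2" by auto
  have "A *v v = (- s) *\<^sub>R v" using v(2) by (metis minus_minus scaleR_minus_left)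
  then have sE: "- s \<in> ?E"
    using v(1) unfolding eigenvalue_def mem_Collect_eq scaleR_eq_scalar_mult by blast
  have "?a \<in> ?E" unfolding smallest_eigenvalue_def using sE by (intro Min_in[OF fin]) blast
  then show ev: "eigenvalue A (complex_of_real ?a)" by simp
  then obtain u where u: "u \<noteq> 0" "A *v u = ?a *\<^sub>R u"
    by (auto simp: eigenvalue_def scaleR_eq_scalar_mult)
  have "0 < u \<bullet> (A *v u)" using A u(1) by (simp add: hermitian_pos_def_def inner_eq_Re_cinner)
  then have "0 < ?a * (u \<bullet> u)" using u(2) by simp
  then show "0 < ?a" using u(1) by (intro zero_less_mult_pos2[of ?a "u \<bullet> u"]) auto
  \<comment> \<open>As \<open>- s\<close> is one of the eigenvalues, the minimum lies below it,
    which is the direction that coercivity needs.\<close>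
  have "?a \<le> - s" unfolding smallest_eigenvalue_def using fin sE by (rule Min_le)
  show "coercive ?a A" unfolding coercive_def
  proof
    fix x :: "complex^'n"
    have "?a * (norm x)\<^sup>2 \<le> - s * (norm x)\<^sup>2" using \<open>?a \<le> - s\<close> by (rule mult_right_mono) simp
    also have "\<dots> \<le> x \<bullet> (A *v x)" using s[of x] by simp
    finally show "?a * (norm x)\<^sup>2 \<le> x \<bullet> (A *v x)" .
  qed
qed

lemma abs_real_eigenvalue_le_norm2:
  fixes A :: "complex^'n^'n"
  assumes "v \<noteq> 0" "A *v v = l *\<^sub>R v"
  shows "\<bar>l\<bar> \<le> norm2 A"
proof -
  have "\<bar>l\<bar> * norm v \<le> norm2 A * norm v"
    using onorm[OF matrix_vector_mul_bounded_linear, of A v] assms(2) by (simp add: norm2_def)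
  then show ?thesis using assms(1) by simp
qed

text \<open>Both norms in the condition number are bounded below by eigenvalues:
  \<open>norm2 A\<close> by \<open>\<bar>l\<bar>\<close>, and the norm of the inverse by the
  reciprocal of the smallest eigenvalue.\<close>

lemma eigenvalue_le_condition_number:
  fixes A :: "complex^'n^'n"
  assumes A: "hermitian_pos_def A" and v: "v \<noteq> 0" "A *v v = l *\<^sub>R v"
  shows "l \<le> condition_number A * smallest_eigenvalue A"
proof -
  let ?a = "smallest_eigenvalue A"
  note a = smallest_eigenvalue_hermitian_pos_def[OF A]
  obtain u where u: "u \<noteq> 0" "A *v u = ?a *\<^sub>R u"
    using a(1) by (auto simp: eigenvalue_def scaleR_eq_scalar_mult)
  have "matrix_inv A *v (A *v u) = u"
    by (simp add: matrix_vector_mul_assoc invertible_matrix_inv coercive_invertible[OF a(3,2)])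
  then have "?a *\<^sub>R (matrix_inv A *v u) = u" by (simp add: u matrix_vector_scaleR)
  then have "(1 / ?a) *\<^sub>R (?a *\<^sub>R (matrix_inv A *v u)) = (1 / ?a) *\<^sub>R u" by simp
  then have "matrix_inv A *v u = (1 / ?a) *\<^sub>R u" using a(2) by simp
  from abs_real_eigenvalue_le_norm2[OF u(1) this] have "1 / ?a \<le> norm2 (matrix_inv A)"
    using a(2) by simp
  moreover have "\<bar>l\<bar> \<le> norm2 A" by (rule abs_real_eigenvalue_le_norm2[OF v])
  ultimately have "\<bar>l\<bar> * (1 / ?a) \<le> condition_number A"
    unfolding condition_number_def using a(2) by (intro mult_mono) auto
  then have "\<bar>l\<bar> \<le> condition_number A * ?a" using a(2) by (simp add: divide_le_eq)
  then show ?thesis by simp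
qed

text \<open>The preceding bound, taken at the smallest eigenvalue itself.\<close>

lemma one_le_condition_number:
  assumes "hermitian_pos_def A"
  shows "1 \<le> condition_number A"
proof -
  note a = smallest_eigenvalue_hermitian_pos_def[OF assms]
  have "smallest_eigenvalue A \<le> condition_number A * smallest_eigenvalue A"
    using a(1) eigenvalue_le_condition_number[OF assms]
    by (auto simp: eigenvalue_def scaleR_eq_scalar_mult)
  then show ?thesis using a(2) by simp
qed

section \<open>The error of the Arnoldi approximation\<close>

lemma ctranspose_matrix_inv:
  assumes "invertible M"
  shows "ctranspose (matrix_inv M) = matrix_inv (ctranspose M)"
  by (rule matrix_inv_unique[symmetric])
    (simp_all add: ctranspose_mult[symmetric] invertible_matrix_inv assms)

lemma arnoldi_resolvent_error:
  fixes A :: "complex^'n^'n" and V :: "complex^('m::{finite,linorder})^'n"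
  assumes A: "hermitian_pos_def A" and y: "norm y = 1"
    and dim: "vec.dim (krylov A y CARD('m)) = CARD('m)"
    and V: "V = arnoldi_basis A y" and t: "0 \<le> t"
  defines "\<kappa> \<equiv> condition_number A" and "a \<equiv> smallest_eigenvalue A"
  shows "norm (resolvent A t *v y - V *v (resolvent (ctranspose V ** A ** V) t *v unit1))
    \<le> 2 * ((sqrt \<kappa> - 1) / (sqrt \<kappa> + 1)) ^ CARD('m) / (a + t)"
proof -
  let ?B = "A + mat (complex_of_real t)" and ?G = "ctranspose V ** A ** V"
  note a = smallest_eigenvalue_hermitian_pos_def[OF A, folded a_def]
  have VV: "ctranspose V ** V = mat 1" by (rule arnoldi_basis_orthonormal[OF dim V])
  have Ve: "V *v unit1 = y" unfolding V by (rule arnoldi_basis_mult_unit1[OF y])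
  have Vy: "ctranspose V *v y = unit1"
    by (simp add: Ve[symmetric] matrix_vector_mul_assoc VV)
  have rangeV: "range ((*v) V) = arnoldi_space A y CARD('m)" by (rule range_arnoldi_basis[OF V])
  have herm: "ctranspose ?B = ?B" using A by (simp add: hermitian_pos_def_def ctranspose_add)
  have coB: "coercive (a + t) ?B" by (rule coercive_add_mat[OF a(3)])
  have coG: "coercive a ?G" by (rule coercive_compression[OF a(3) VV])
  have at: "0 < a + t" using a(2) t by simp
  define x where "x = resolvent A t *v y"
  define g where "g = resolvent ?G t *v unit1"
  have Bx: "?B *v x = y"
    by (simp add: x_def matrix_vector_mul_assoc invertible_matrix_inv invertible_add_mat[OF a(3,2) t])
  have "(?G + mat (complex_of_real t)) *v g = unit1"
    unfolding g_def matrix_vector_mul_assoc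
    by (simp add: invertible_matrix_inv invertible_add_mat[OF coG a(2) t])
  \<comment> \<open>Orthonormal columns make compression commute with the shift, so one Krylov basis
    gives the Galerkin approximation for every \<open>t\<close>.\<close>
  moreover have "ctranspose V *v (?B *v (V *v g)) = (?G + mat (complex_of_real t)) *v g"
  proof -
    have "ctranspose V *v (?B *v (V *v g)) = ?G *v g + t *\<^sub>R (ctranspose V *v (V *v g))"
      by (simp add: matrix_vector_mult_add_rdistrib matrix_vector_right_distrib mat_of_real
          scaleR_matrix_vector matrix_vector_scaleR matrix_vector_mul_assoc[symmetric])
    then show ?thesis
      by (simp add: matrix_vector_mult_add_rdistrib mat_of_real scaleR_matrix_vector
          matrix_vector_mul_assoc VV)
  qed
  ultimately have galerkin: "ctranspose V *v (?B *v (x - V *v g)) = 0"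
    by (simp add: matrix_vector_mult_diff_distrib Bx Vy)
  have "norm (x - V *v g) \<le> 2 * ((sqrt \<kappa> - 1) / (sqrt \<kappa> + 1)) ^ CARD('m) / (a + t) * norm (?B *v x)"
  proof (rule galerkin_error_bound[where T = "(*v) ?B" and S = "arnoldi_space A y"])
    show "linear ((*v) ?B)" by simp
    show "u \<bullet> (?B *v w) = (?B *v u) \<bullet> w" for u w by (simp add: inner_adjoint herm)
    show "0 < a + t" by (rule at)
    show "(a + t) * (norm u)\<^sup>2 \<le> u \<bullet> (?B *v u)" for u using coB by (simp add: coercive_def)
    show \<kappa>: "1 \<le> \<kappa>" unfolding \<kappa>_def by (rule one_le_condition_number[OF A])
    \<comment> \<open>Eigenvalues of \<open>?B\<close> are those of \<open>A\<close> moved by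
      \<open>t\<close>, and \<open>\<kappa> * a + t \<le> \<kappa> * (a + t)\<close>; hence the
      condition number of \<open>A\<close> serves for all shifts.\<close>
    fix v l assume v: "v \<noteq> 0" "?B *v v = l *\<^sub>R v"
    have "A *v v = (l - t) *\<^sub>R v"
      using v(2) by (simp add: matrix_vector_mult_add_rdistrib mat_of_real scaleR_matrix_vector
          scaleR_left_diff_distrib eq_diff_eq)
    then have "l - t \<le> \<kappa> * a"
      unfolding \<kappa>_def a_def using eigenvalue_le_condition_number[OF A v(1)] by blast
    moreover have "t \<le> \<kappa> * t" using mult_right_mono[OF \<kappa> t] by simp
    ultimately show "l \<le> \<kappa> * (a + t)" by (simp add: distrib_left)
  next
    show "subspace (arnoldi_space A y j)" for j
      by (intro vec_subspace_imp_subspace vec.subspace_span)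
    show mono: "arnoldi_space A y j \<subseteq> arnoldi_space A y (Suc j)" for j
      by (rule arnoldi_space_mono) simp
    \<comment> \<open>The spaces start at \<open>y\<close>, the image of \<open>x\<close>, so
      residual polynomials of degree \<open>CARD('m)\<close> are available and the exponent is the
      full dimension.\<close>
    show "?B *v x \<in> arnoldi_space A y 1" unfolding Bx using start_mem_arnoldi_space by simp
    show "?B *v u \<in> arnoldi_space A y (Suc j)" if "u \<in> arnoldi_space A y j" for u j
      using mult_arnoldi_space_mem[OF that] mono[of j] that
      by (auto simp: matrix_vector_mult_add_rdistrib mat_mult_vector intro!: vec.span_add vec.span_scale)
    show "V *v g \<in> arnoldi_space A y CARD('m)" unfolding rangeV[symmetric] by simp
    fix u assume "u \<in> arnoldi_space A y CARD('m)"
    then obtain c where c: "u = V *v c" unfolding rangeV[symmetric] by blast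
    have "u \<bullet> (?B *v (x - V *v g)) = c \<bullet> (ctranspose V *v (?B *v (x - V *v g)))"
      by (simp add: c inner_adjoint[of c])
    then show "u \<bullet> (?B *v (x - V *v g)) = 0" using galerkin by simp
  qed
  then show ?thesis unfolding Bx y by (simp add: x_def g_def)
qed

text \<open>Telescoping through the mixed product of \<open>w\<close> and \<open>x'\<close>, so that
  besides the two errors only the sizes of \<open>x'\<close> and \<open>w\<close> enter.\<close>

lemma outer_difference_bound:
  assumes "norm (x - x') \<le> e" "norm (w - w') \<le> e" "norm x' \<le> b" "norm w \<le> b"
  shows "norm (cinner w' u *s x' - cinner w u *s x) \<le> 2 * e * b * norm u"
proof -
  have "cinner w' u *s x' - cinner w u *s x = - (cinner (w - w') u *s x') - cinner w u *s (x - x')"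
    by (simp add: vec_eq_iff cinner_def algebra_simps sum_subtractf)
  also have "norm \<dots> \<le> norm (w - w') * norm u * norm x' + norm w * norm u * norm (x - x')"
    by (rule order_trans[OF norm_triangle_ineq4])
      (unfold norm_minus_cancel norm_scalar_mult, intro add_mono mult_right_mono norm_cinner_le norm_ge_zero)
  also have "\<dots> \<le> e * norm u * b + b * norm u * e"
    using assms order_trans[OF norm_ge_zero assms(1)] order_trans[OF norm_ge_zero assms(3)]
    by (intro add_mono mult_mono mult_right_mono) auto
  finally show ?thesis by (simp add: mult_ac)
qed

theorem theorem4:
  fixes A :: "complex^'n^'n"
    and y z :: "complex^'n"
    and \<eta> :: complex
    and f :: "complex \<Rightarrow> complex"
    and \<mu> :: "real \<Rightarrow> real"
    and V W :: "complex^('m::{finite,linorder})^'n"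
  assumes "hermitian_pos_def A"
    and "norm y = 1" and "norm z = 1"
    and "stieltjes_function f \<mu>"
    and "vec.dim (krylov A y CARD('m)) = CARD('m)"
    and "vec.dim (krylov (ctranspose A) z CARD('m)) = CARD('m)"
    and "V = arnoldi_basis A y"
    and "W = arnoldi_basis (ctranspose A) z"
  shows "norm2 (frechet_derivative (stieltjes_matrix_fun \<mu>) (at A) (outer (\<eta> *s y) z)
                - arnoldi_approx \<mu> A \<eta> y z V W)
         \<le> 4 * cmod (\<eta> * deriv f (complex_of_real (smallest_eigenvalue A)))
           * ((sqrt (condition_number A) - 1) / (sqrt (condition_number A) + 1)) ^ CARD('m)"
proof -
  define N where "N = half_line_restriction \<mu>"
  interpret half_line_measure N
    unfolding N_def by (rule half_line_measure_restriction[OF assms(4)])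
  define a where "a = smallest_eigenvalue A"
  note A = smallest_eigenvalue_hermitian_pos_def[OF assms(1), folded a_def]
  have herm: "ctranspose A = A" using assms(1) by (simp add: hermitian_pos_def_def)
  define r where "r = ((sqrt (condition_number A) - 1) / (sqrt (condition_number A) + 1)) ^ CARD('m)"
  define G where "G = ctranspose V ** A ** V"
  define H where "H = ctranspose W ** A ** W"
  have VV: "ctranspose V ** V = mat 1" by (rule arnoldi_basis_orthonormal[OF assms(5,7)])
  have WW: "ctranspose W ** W = mat 1" by (rule arnoldi_basis_orthonormal[OF assms(6,8)])
  have G: "coercive a G" unfolding G_def by (rule coercive_compression[OF A(3) VV])
  have H: "coercive a H" unfolding H_def by (rule coercive_compression[OF A(3) WW])
  have hermH: "ctranspose H = H"
    by (simp add: H_def ctranspose_mult herm matrix_mul_assoc)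
  have fun_eq: "stieltjes_matrix_fun \<mu> M = (\<integral>t. resolvent M t \<partial>N)" for M :: "complex^'k^'k"
    by (simp add: stieltjes_matrix_fun_def set_integral_stieltjes_measure N_def)

  let ?E = "outer (\<eta> *s y) z" and ?Q = "outer (\<eta> *s unit1) unit1 :: complex^('m::{finite,linorder})^('m::{finite,linorder})"
  define F1 where "F1 t = - (resolvent A t ** ?E ** resolvent A t)" for t
  define F2 where "F2 t = V ** (- (resolvent G t ** ?Q ** resolvent H t)) ** ctranspose W" for t
  have intF1: "integrable N F1"
    unfolding F1_def using integrable_resolvent_product[OF A(3) A(3) A(2)] by simp
  have bl: "bounded_linear (\<lambda>X. V ** X ** ctranspose W)"
    by (intro bounded_linear_compose[OF bounded_bilinear.bounded_linear_left[OF bounded_bilinear_matrix_mult]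
          bounded_bilinear.bounded_linear_right[OF bounded_bilinear_matrix_mult]])
  have intQ: "integrable N (\<lambda>t. - (resolvent G t ** ?Q ** resolvent H t))"
    using integrable_resolvent_product[OF G H A(2)] by simp
  have intF2: "integrable N F2"
    unfolding F2_def by (rule integrable_bounded_linear[OF bl intQ])

  have "(stieltjes_matrix_fun \<mu> has_derivative
      (\<lambda>E. \<integral>t. - (resolvent A t ** E ** resolvent A t) \<partial>N)) (at A)"
    unfolding fun_eq[abs_def] by (rule has_derivative_integral_resolvent[OF A(3,2)])
  \<comment> \<open>\<open>frechet_derivative\<close> is defined by choice; uniqueness of the
    derivative identifies it with the integral.\<close>
  then have "frechet_derivative (stieltjes_matrix_fun \<mu>) (at A) ?E = (\<integral>t. F1 t \<partial>N)"
    by (simp add: frechet_derivative_at[symmetric] F1_def)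
  moreover have "arnoldi_approx \<mu> A \<eta> y z V W = (\<integral>t. F2 t \<partial>N)"
  proof -
    have "arnoldi_approx \<mu> A \<eta> y z V W
        = V ** (\<integral>t. - (resolvent G t ** ?Q ** resolvent H t) \<partial>N) ** ctranspose W"
      unfolding arnoldi_approx_def Let_def herm G_def[symmetric] H_def[symmetric] hermH
        fun_eq block12_integral_resolvent[OF G H A(2)] assms(2,3) by simp
    also have "\<dots> = (\<integral>t. F2 t \<partial>N)"
      unfolding F2_def by (rule integral_bounded_linear[OF bl intQ, symmetric])
    finally show ?thesis .
  qed
  ultimately have "norm2 (frechet_derivative (stieltjes_matrix_fun \<mu>) (at A) ?E
      - arnoldi_approx \<mu> A \<eta> y z V W) = norm2 (\<integral>t. F1 t - F2 t \<partial>N)"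
    using intF1 intF2 by simp
  also have "\<dots> \<le> (\<integral>t. 4 * cmod \<eta> * r * (1 / (a + t)\<^sup>2) \<partial>N)"
  proof (rule norm2_integral_le)
    show "integrable N (\<lambda>t. F1 t - F2 t)" using intF1 intF2 by simp
    show "integrable N (\<lambda>t. 4 * cmod \<eta> * r * (1 / (a + t)\<^sup>2))"
      using integrable_inverse_shift_square[OF A(2)] by (rule integrable_mult_right)
    fix t :: real and u :: "complex^'n" assume t: "0 \<le> t"
    define x where "x = resolvent A t *v y"
    define w where "w = resolvent A t *v z"
    define x' where "x' = V *v (resolvent G t *v unit1)"
    define w' where "w' = W *v (resolvent H t *v unit1)"
    \<comment> \<open>Hermitian resolvents can be moved onto the left factor of the scalar product,
      where they produce \<open>w\<close> and \<open>w'\<close>.\<close>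
    have hermA: "ctranspose (resolvent A t) = resolvent A t"
      by (simp add: ctranspose_matrix_inv invertible_add_mat[OF A(3,2) t] ctranspose_add herm)
    have hermH': "ctranspose (resolvent H t) = resolvent H t"
      by (simp add: ctranspose_matrix_inv invertible_add_mat[OF H A(2) t] ctranspose_add hermH)
    note minus = bounded_bilinear.minus_left[OF bounded_bilinear_matrix_vector]
    have F1: "F1 t *v u = - (\<eta> *s (cinner w u *s x))"
    proof -
      have "F1 t *v u = - (resolvent A t *v (?E *v (resolvent A t *v u)))"
        by (simp add: F1_def minus matrix_vector_mul_assoc matrix_mul_assoc)
      also have "\<dots> = - (cinner z (resolvent A t *v u) *s (\<eta> *s x))"
        by (simp add: outer_mult_vector vector_scalar_commute x_def)
      also have "cinner z (resolvent A t *v u) = cinner w u"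
        by (simp add: cinner_adjoint hermA w_def)
      finally show ?thesis by (simp add: mult.commute)
    qed
    have F2: "F2 t *v u = - (\<eta> *s (cinner w' u *s x'))"
    proof -
      have "F2 t *v u
          = - (V *v (resolvent G t *v (?Q *v (resolvent H t *v (ctranspose W *v u)))))"
        by (simp add: F2_def minus matrix_vector_mul_assoc matrix_mul_assoc
            bounded_bilinear.minus_left[OF bounded_bilinear_matrix_mult]
            bounded_bilinear.minus_right[OF bounded_bilinear_matrix_mult])
      also have "\<dots> = - (cinner unit1 (resolvent H t *v (ctranspose W *v u)) *s (\<eta> *s x'))"
        by (simp add: outer_mult_vector vector_scalar_commute x'_def)
      also have "cinner unit1 (resolvent H t *v (ctranspose W *v u)) = cinner w' u"
        by (simp add: cinner_adjoint hermH' w'_def)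
      finally show ?thesis by (simp add: mult.commute)
    qed
    have ex: "norm (x - x') \<le> 2 * r / (a + t)"
      unfolding x_def x'_def G_def r_def a_def
      by (rule arnoldi_resolvent_error[OF assms(1,2,5,7) t])
    have ew: "norm (w - w') \<le> 2 * r / (a + t)"
      unfolding w_def w'_def H_def r_def a_def
      by (rule arnoldi_resolvent_error[OF assms(1,3) _ _ t]) (use assms(6,8) herm in simp_all)
    have bw: "norm w \<le> 1 / (a + t)"
      using norm_resolvent_mult_le[OF A(3,2) t, of z] assms(3) by (simp add: w_def)
    have bx: "norm x' \<le> 1 / (a + t)"
      using norm_resolvent_mult_le[OF G A(2) t, of unit1] by (simp add: x'_def norm_orthonormal_mult[OF VV] unit1_def)
    have "(F1 t - F2 t) *v u = \<eta> *s (cinner w' u *s x' - cinner w u *s x)"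
      by (simp add: matrix_vector_mult_diff_rdistrib F1 F2 vec.scale_right_diff_distrib)
    then have "norm ((F1 t - F2 t) *v u) = cmod \<eta> * norm (cinner w' u *s x' - cinner w u *s x)"
      by (simp only: norm_scalar_mult)
    \<comment> \<open>The constant 4 is the product of 2 for the two telescoped terms and 2 from the
      Galerkin error.\<close>
    also have "\<dots> \<le> cmod \<eta> * (2 * (2 * r / (a + t)) * (1 / (a + t)) * norm u)"
      by (intro mult_left_mono outer_difference_bound ex ew bx bw) simp
    finally show "norm ((F1 t - F2 t) *v u) \<le> 4 * cmod \<eta> * r * (1 / (a + t)\<^sup>2) * norm u"
      by (simp add: power2_eq_square mult_ac)
  qed
  also have "\<dots> = 4 * cmod (\<eta> * deriv f (complex_of_real a)) * r"
  proof -
    \<comment> \<open>Since \<open>deriv f\<close> at \<open>a\<close> is minus this integral,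
      nonnegativity makes its modulus equal to the integral.\<close>
    have "0 \<le> (\<integral>t. 1 / (a + t)\<^sup>2 \<partial>N)" by (intro integral_nonneg_AE AE_I2) simp
    then show ?thesis
      unfolding deriv_stieltjes_function[OF assms(4) A(2)] N_def[symmetric]
      by (simp only: integral_mult_right_zero norm_mult norm_minus_cancel norm_of_real abs_of_nonneg mult_ac)
  qed
  finally show ?thesis unfolding r_def a_def .
qed

end
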